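(* Let $\mathfrak{g}$ be a finite dimensional Lie algebra of vector fields on (some open subset of) $\mathbb{C}^2$ that is solvable and not nilpotent, and suppose that the rank of $\mathfrak{g}$ is $1$. Then, in suitable local coordinates $(x,y)$, $$\mathfrak{g} \,=\, \langle x\partial_x\rangle + \mathfrak{g}' \quad\text{and}\quad \mathfrak{g}' \,=\, \langle \phi_1(y)\partial_x,\, \ldots,\, \phi_N(y)\partial_x\rangle ,$$ where $\mathfrak{g}'=[\mathfrak{g},\mathfrak{g}]$ and $\phi_1,\ldots,\phi_N$ are linearly independent $C^\infty$ functions of $y$.
   Context: All vector fields are $C^\infty$, and a Lie algebra of vector fields on $\mathbb{C}^2$ means a Lie algebra (under the Lie bracket) of vector fields $P(x,y)\partial_x+Q(x,y)\partial_y$ defined on some open subset of $\mathbb{C}^2$. The rank of a Lie algebra of vector fields is the dimension of its generic orbit (equivalently, the dimension of the span of its vector fields at a generic point). Here $\partial_x=\frac{\partial}{\partial x}$, $\partial_y=\frac{\partial}{\partial y}$, and $\langle\,\cdot\,\rangle$ denotes $\mathbb{C}$-linear span. "In suitable coordinates" means up to a locally defined $C^\infty$ change of variables (point transformation), possibly after shrinking the open set. *)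

theory Defs
  imports "HOL-Complex_Analysis.Complex_Analysis" "HOL-Library.Function_Algebras"
    "HOL-Library.Set_Algebras"
begin

section \<open>Calculus on open subsets of \<open>\<complex>\<^sup>2\<close>\<close>

text \<open>
  A point \<open>p\<close> of \<open>\<complex>\<^sup>2\<close> has coordinates \<open>x = p $ 1\<close> and \<open>y = p $ 2\<close>. The operators \<open>\<partial>\<^sub>x\<close>, \<open>\<partial>\<^sub>y\<close> are
  complex partial derivatives, and \<open>C\<^sup>\<infinity>\<close> is understood accordingly: all iterated complex partial
  derivatives exist and are continuous. Values of \<open>cpd\<close> are meaningful only where the derivative
  exists.
\<close>

definition cpd :: "2 \<Rightarrow> (complex^2 \<Rightarrow> complex) \<Rightarrow> complex^2 \<Rightarrow> complex" where
  "cpd i f p = deriv (\<lambda>t. f (p + axis i t)) 0"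

primrec C_k_on :: "nat \<Rightarrow> (complex^2) set \<Rightarrow> (complex^2 \<Rightarrow> complex) \<Rightarrow> bool" where
  "C_k_on 0 U f \<longleftrightarrow> continuous_on U f"
| "C_k_on (Suc k) U f \<longleftrightarrow> continuous_on U f \<and>
     (\<forall>i. (\<forall>p\<in>U. (\<lambda>t. f (p + axis i t)) field_differentiable (at 0)) \<and> C_k_on k U (cpd i f))"

definition C_inf_on :: "(complex^2) set \<Rightarrow> (complex^2 \<Rightarrow> complex) \<Rightarrow> bool" where
  "C_inf_on U f \<longleftrightarrow> (\<forall>k. C_k_on k U f)"

definition C_inf_map_on :: "(complex^2) set \<Rightarrow> (complex^2 \<Rightarrow> complex^2) \<Rightarrow> bool" where
  "C_inf_map_on U F \<longleftrightarrow> (\<forall>i. C_inf_on U (\<lambda>p. F p $ i))"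

definition C_inf1_on :: "complex set \<Rightarrow> (complex \<Rightarrow> complex) \<Rightarrow> bool" where
  "C_inf1_on D f \<longleftrightarrow> (\<forall>k. (deriv ^^ k) f holomorphic_on D)"

definition cjac :: "(complex^2 \<Rightarrow> complex^2) \<Rightarrow> complex^2 \<Rightarrow> complex^2^2" where
  "cjac F p = (\<chi> i j. cpd j (\<lambda>q. F q $ i) p)"

text \<open>\<open>P\<close> holds at a generic point of \<open>U\<close>, i.e. on an open dense subset.\<close>

definition generically :: "(complex^2) set \<Rightarrow> (complex^2 \<Rightarrow> bool) \<Rightarrow> bool" where
  "generically U P \<longleftrightarrow> (\<exists>G. open G \<and> G \<subseteq> U \<and> U \<subseteq> closure G \<and> (\<forall>p\<in>G. P p))"


section \<open>Vector fields\<close>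

text \<open>
  A vector field \<open>P \<partial>\<^sub>x + Q \<partial>\<^sub>y\<close> on \<open>U\<close> is represented by the total function \<open>p \<mapsto> (P p, Q p)\<close> extended
  by zero outside \<open>U\<close>, so that equality of functions is equality of vector fields on \<open>U\<close> and the
  pointwise operations are those of the complex vector space of vector fields on \<open>U\<close>.
\<close>

type_synonym vfield = "complex^2 \<Rightarrow> complex^2"

definition vfield_on :: "(complex^2) set \<Rightarrow> vfield \<Rightarrow> bool" where
  "vfield_on U X \<longleftrightarrow> C_inf_map_on U X \<and> (\<forall>p. p \<notin> U \<longrightarrow> X p = 0)"

definition vf_scale :: "complex \<Rightarrow> vfield \<Rightarrow> vfield" where
  "vf_scale c X = (\<lambda>p. c *s X p)"

global_interpretation vf: vector_space vf_scale
  by unfold_locales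
    (auto simp: vf_scale_def fun_eq_iff vec.scale_right_distrib vec.scale_left_distrib)

definition vf_of :: "(complex^2) set \<Rightarrow> (complex^2 \<Rightarrow> complex) \<Rightarrow> (complex^2 \<Rightarrow> complex) \<Rightarrow> vfield" where
  "vf_of U P Q = (\<lambda>p. if p \<in> U then vector [P p, Q p] else 0)"

text \<open>
  In components, \<open>[X, Y]\<^sup>i = \<Sum>\<^sub>j X\<^sup>j \<partial>\<^sub>j Y\<^sup>i - Y\<^sup>j \<partial>\<^sub>j X\<^sup>i\<close>. For vector fields on \<open>U\<close> this is zero outside
  \<open>U\<close>, whatever the value of \<open>cjac\<close> there.
\<close>

definition lie_bracket :: "vfield \<Rightarrow> vfield \<Rightarrow> vfield" where
  "lie_bracket X Y = (\<lambda>p. cjac Y p *v X p - cjac X p *v Y p)"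


section \<open>Lie algebras of vector fields\<close>

definition vf_lie_algebra :: "(complex^2) set \<Rightarrow> vfield set \<Rightarrow> bool" where
  "vf_lie_algebra U \<gg> \<longleftrightarrow> vf.subspace \<gg> \<and> (\<forall>X\<in>\<gg>. vfield_on U X) \<and>
     (\<forall>X\<in>\<gg>. \<forall>Y\<in>\<gg>. lie_bracket X Y \<in> \<gg>)"

definition vf_finite_dim :: "vfield set \<Rightarrow> bool" where
  "vf_finite_dim \<gg> \<longleftrightarrow> (\<exists>B. finite B \<and> \<gg> = vf.span B)"

definition lie_product :: "vfield set \<Rightarrow> vfield set \<Rightarrow> vfield set" where
  "lie_product A B = vf.span {lie_bracket X Y | X Y. X \<in> A \<and> Y \<in> B}"

definition derived_algebra :: "vfield set \<Rightarrow> vfield set" where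
  "derived_algebra \<gg> = lie_product \<gg> \<gg>"

definition vf_solvable :: "vfield set \<Rightarrow> bool" where
  "vf_solvable \<gg> \<longleftrightarrow> (\<exists>n. (derived_algebra ^^ n) \<gg> = {0})"

definition vf_nilpotent :: "vfield set \<Rightarrow> bool" where
  "vf_nilpotent \<gg> \<longleftrightarrow> (\<exists>n. (lie_product \<gg> ^^ n) \<gg> = {0})"

definition has_rank :: "(complex^2) set \<Rightarrow> vfield set \<Rightarrow> nat \<Rightarrow> bool" where
  "has_rank U \<gg> r \<longleftrightarrow> generically U (\<lambda>p. vec.dim ((\<lambda>X. X p) ` \<gg>) = r)"


section \<open>Changes of variables\<close>

definition coordinate_change ::
  "(complex^2) set \<Rightarrow> (complex^2) set \<Rightarrow> (complex^2 \<Rightarrow> complex^2) \<Rightarrow> (complex^2 \<Rightarrow> complex^2) \<Rightarrow> bool"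
where
  "coordinate_change V W \<Phi> \<Psi> \<longleftrightarrow> open V \<and> open W \<and> homeomorphism V W \<Phi> \<Psi> \<and>
     C_inf_map_on V \<Phi> \<and> C_inf_map_on W \<Psi>"

text \<open>
  The expression in the new coordinates of the restriction of \<open>X\<close> to \<open>V = \<Psi> ` W\<close>: the push-forward
  of \<open>X\<close> under \<open>\<Phi> : V \<rightarrow> W\<close>, where \<open>\<Psi>\<close> is the inverse of \<open>\<Phi>\<close>.
\<close>

definition push_forward ::
  "(complex^2) set \<Rightarrow> (complex^2 \<Rightarrow> complex^2) \<Rightarrow> (complex^2 \<Rightarrow> complex^2) \<Rightarrow> vfield \<Rightarrow> vfield"
where
  "push_forward W \<Phi> \<Psi> X = (\<lambda>q. if q \<in> W then cjac \<Phi> (\<Psi> q) *v X (\<Psi> q) else 0)"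

definition lin_indep_on :: "complex set \<Rightarrow> nat \<Rightarrow> (nat \<Rightarrow> complex \<Rightarrow> complex) \<Rightarrow> bool" where
  "lin_indep_on D N \<phi> \<longleftrightarrow>
     (\<forall>c. (\<forall>y\<in>D. (\<Sum>i=1..N. c i * \<phi> i y) = 0) \<longrightarrow> (\<forall>i\<in>{1..N}. c i = 0))"

text \<open>
  \<open>\<hh>\<close> is a Lie algebra of vector fields on \<open>W\<close> with \<open>\<hh> = \<langle>x \<partial>\<^sub>x\<rangle> + \<hh>'\<close> and
  \<open>\<hh>' = \<langle>\<phi>\<^sub>1(y) \<partial>\<^sub>x, \<dots>, \<phi>\<^sub>N(y) \<partial>\<^sub>x\<rangle>\<close>. The \<open>\<phi>\<^sub>i\<close> are functions on the set of values of \<open>y\<close> on \<open>W\<close>.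
\<close>

definition rank_one_form :: "(complex^2) set \<Rightarrow> vfield set \<Rightarrow> bool" where
  "rank_one_form W \<hh> \<longleftrightarrow> \<hh> = vf.span {vf_of W (\<lambda>q. q $ 1) (\<lambda>q. 0)} + derived_algebra \<hh> \<and>
     (\<exists>N \<phi>. derived_algebra \<hh> = vf.span {vf_of W (\<lambda>q. \<phi> i (q $ 2)) (\<lambda>q. 0) | i. i \<in> {1..N}} \<and>
        (\<forall>i\<in>{1..N}. C_inf1_on ((\<lambda>q. q $ 2) ` W) (\<phi> i)) \<and>
        lin_indep_on ((\<lambda>q. q $ 2) ` W) N \<phi>)"

text \<open>
  Near \<open>p\<close> there are coordinates in which (the restriction of) \<open>\<gg>\<close> has the form \<open>F\<close>. For a connected
  domain, restriction to a nonempty open subset is injective on vector fields. On a disconnected one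
  it need not be: \<open>\<gg>\<close> may be non-nilpotent on one connected component and abelian on another, so
  there a normal form can only be asserted on a suitable component.
\<close>

definition locally_in_suitable_coordinates ::
  "(complex^2) set \<Rightarrow> vfield set \<Rightarrow> ((complex^2) set \<Rightarrow> vfield set \<Rightarrow> bool) \<Rightarrow> complex^2 \<Rightarrow> bool"
where
  "locally_in_suitable_coordinates U \<gg> F p \<longleftrightarrow>
     (\<exists>V W \<Phi> \<Psi>. p \<in> V \<and> V \<subseteq> U \<and> coordinate_change V W \<Phi> \<Psi> \<and> F W (push_forward W \<Phi> \<Psi> ` \<gg>))"

end

theory Submission
  imports Defs
begin

text \<open>
  The last derived algebra \<open>\<aa>\<close> of \<open>\<gg>\<close> that does not vanish on a suitable component is an abelian ideal.
  Near a point where some \<open>X \<in> \<aa>\<close> does not vanish, rank one gives \<open>Z = f X\<close> for every \<open>Z \<in> \<gg>\<close>. The function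
  \<open>\<phi> = X f\<close> satisfies \<open>X \<phi> = 0\<close>, and iterating \<open>ad Z\<close> on \<open>X\<close> gives the fields \<open>(- \<phi>)\<^sup>n X \<in> \<aa>\<close>, so \<open>\<phi>\<close> is
  constant by finite dimension. As \<open>\<gg>\<close> is not abelian, the constant is nonzero for some \<open>Z\<close>; normalising,
  some \<open>Y = u X \<in> \<gg>\<close> has \<open>X u = 1\<close>. With a first integral \<open>v\<close> of \<open>X\<close>, the coordinates \<open>(x, y) = (u, v)\<close> turn
  \<open>X\<close> into \<open>\<partial>\<^sub>x\<close>, \<open>Y\<close> into \<open>x \<partial>\<^sub>x\<close> and every \<open>Z\<close> into \<open>(c x + \<eta>(y)) \<partial>\<^sub>x\<close>, from which \<open>\<gg>' = {\<eta>(y) \<partial>\<^sub>x \<in> \<gg>}\<close>.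
\<close>

section \<open>Holomorphic functions of two variables\<close>

text \<open>Since \<open>cpd\<close> is a complex derivative, smooth functions here are holomorphic,
  and the proof lives on that rigidity: a bracket vanishing on a small ball vanishes on the whole
  component. Nothing carries over between components, so the component is chosen to contain a point
  with a nonzero bracket, and the derived series is tested only there. Some constant is nonzero
  because otherwise X f = 0 for all multipliers f, and [f X, g X] = (f X g - g X f) X would kill
  every bracket where X \<noteq> 0, hence on the component. Constancy itself is a root count: a
  dependence among the powers of \<phi> times X is a polynomial equation for \<phi>, which leaves
  finitely many values on a connected ball. The delicate construction is the first integral. Its
  series uses iterated derivatives along X, each of which costs part of the domain; spreading the
  loss evenly over n steps costs a factor n^n, which the factorial in the series absorbs. In the
  final chart \<open>[\<eta>(y) \<partial>\<^sub>x, x \<partial>\<^sub>x] = \<eta>(y)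
  \<partial>\<^sub>x\<close>, so every field without an x-term is itself a bracket.\<close>

no_notation fps_nth (infixl \<open>$\<close> 75)

lemma axis_add: "axis i (s + t) = axis i s + axis i (t::'a::monoid_add)"
  by (simp add: vec_eq_iff axis_def)

lemma axis_mult: "axis i (c * t) = c *s axis i (t::'a::semiring_0)"
  by (simp add: vec_eq_iff axis_def)

lemma axis_scaleR: "axis i (r *\<^sub>R t) = r *\<^sub>R axis i (t::'a::real_vector)"
  by (simp add: vec_eq_iff axis_def)

lemma axis_zero: "axis i 0 = 0"
  by (simp add: vec_eq_iff axis_def)

lemma norm_axis: "norm (axis i t :: 'a::real_normed_vector^'n) = norm t"
proof -
  have "(\<Sum>j\<in>UNIV. (norm ((axis i t :: 'a^'n) $ j))\<^sup>2) = (\<Sum>j\<in>UNIV. if j = i then (norm t)\<^sup>2 else 0)"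
    by (intro sum.cong) (auto simp: axis_def)
  then show ?thesis
    by (simp add: norm_vec_def L2_set_def)
qed

lemma bounded_linear_axis: "bounded_linear (axis i :: 'a::real_normed_vector \<Rightarrow> 'a^'n)"
  by (rule bounded_linear_intro[where K=1]) (auto simp: axis_add axis_scaleR norm_axis)

lemmas continuous_on_axis [continuous_intros] = bounded_linear.continuous_on[OF bounded_linear_axis]

lemma axis_add_axis [simp]:
  "axis 1 (p$1) + axis 2 ((p::complex^2)$2) = p" "axis 2 (p$2) + axis 1 ((p::complex^2)$1) = p"
  by (simp_all add: vec_eq_iff axis_def forall_2)

section \<open>Separate holomorphy and Cauchy's formula\<close>

definition partially_hol_on :: "(complex^2) set \<Rightarrow> (complex^2 \<Rightarrow> complex) \<Rightarrow> bool" where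
  "partially_hol_on U f \<longleftrightarrow> continuous_on U f \<and>
     (\<forall>i. \<forall>p\<in>U. (\<lambda>t. f (p + axis i t)) field_differentiable (at 0))"

lemma slice_has_derivative:
  assumes "partially_hol_on U f" "p + axis i s \<in> U"
  shows "((\<lambda>t. f (p + axis i t)) has_field_derivative cpd i f (p + axis i s)) (at s)"
proof -
  have "(\<lambda>t. f (p + axis i s + axis i t)) field_differentiable at 0"
    using assms unfolding partially_hol_on_def by blast
  then have "((\<lambda>t. f (p + axis i s + axis i t)) has_field_derivative cpd i f (p + axis i s)) (at 0)"
    unfolding cpd_def by (simp add: field_differentiable_derivI)
  then show ?thesis
    using DERIV_shift[of "\<lambda>t. f (p + axis i t)" "cpd i f (p + axis i s)" 0 s]
    by (simp add: axis_add add_ac)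
qed

text \<open>The velocity of the circle is 2 pi i times \<open>circlepath 0 r t\<close>, which
  cancels one power in Cauchy's formula for the derivative. What remains is an integral over the
  fixed interval [0,1] with p only in the integrand, so it can be studied as a parameter
  integral.\<close>

lemma cpd_Cauchy_integral:
  assumes f: "partially_hol_on U f" and U: "\<And>z. norm z \<le> r \<Longrightarrow> p + axis i z \<in> U" and "r > 0"
  shows "cpd i f p = integral {0..1} (\<lambda>t. f (p + axis i (circlepath 0 r t)) / circlepath 0 r t)"
proof -
  let ?g = "\<lambda>t. f (p + axis i t)"
  have der: "(?g has_field_derivative cpd i f (p + axis i s)) (at s)" if "norm s \<le> r" for s
    by (rule slice_has_derivative[OF f U[OF that]])
  have c: "continuous_on (cball 0 r) ?g"
    by (rule continuous_at_imp_continuous_on) (auto intro!: DERIV_isCont der)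
  have h: "?g holomorphic_on ball 0 r"
    by (rule holomorphic_on_open[THEN iffD2]) (auto intro!: der exI)
  have "contour_integral (circlepath 0 r) (\<lambda>u. ?g u/(u-0)^2) = (2 * pi * \<i>) * deriv ?g 0"
    by (rule Cauchy_contour_integral_circlepath_2[OF c h]) (use \<open>r>0\<close> in simp)
  then have "(2 * pi * \<i>) * cpd i f p = contour_integral (circlepath 0 r) (\<lambda>u. ?g u/u^2)"
    by (simp add: cpd_def)
  also have "\<dots> = integral {0..1} (\<lambda>t. (2 * pi * \<i>) * (?g (circlepath 0 r t) / circlepath 0 r t))"
    unfolding contour_integral_integral
  proof (rule integral_cong)
    fix t :: real
    have "vector_derivative (circlepath 0 r) (at t) = 2 * pi * \<i> * circlepath 0 r t"
      by (simp add: vector_derivative_circlepath, simp add: circlepath)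
    moreover have "circlepath 0 r t \<noteq> 0"
      using \<open>r>0\<close> by (simp add: circlepath)
    ultimately show "?g (circlepath 0 r t) / (circlepath 0 r t)\<^sup>2 * vector_derivative (circlepath 0 r) (at t)
        = (2 * pi * \<i>) * (?g (circlepath 0 r t) / circlepath 0 r t)"
      by (simp add: power2_eq_square)
  qed
  also have "\<dots> = (2 * pi * \<i>) * integral {0..1} (\<lambda>t. (?g (circlepath 0 r t) / circlepath 0 r t))"
    by (rule integral_mult_right)
  finally show ?thesis by (simp add: field_simps)
qed

lemma ball_axis_subset:
  assumes "ball p (2*r) \<subseteq> U" "r > 0" "q \<in> ball p r" "norm z < r"
  shows "q + axis i z \<in> U"
proof -
  have "dist p (q + axis i z) \<le> dist p q + norm (axis i z)"
    by (metis dist_triangle dist_norm norm_minus_commute add_diff_cancel_left')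
  then show ?thesis using assms by (auto simp: norm_axis)
qed

lemma continuous_on_circlepath: "continuous_on A (circlepath z r)"
  unfolding circlepath by (intro continuous_intros)

text \<open>The ball of radius 2 r leaves room for one circle radius r/2 that serves all centres in
  \<open>ball p r\<close>, so the formula holds on a whole neighbourhood with the same path.\<close>

lemma cpd_Cauchy_integral_ball:
  assumes f: "partially_hol_on U f" and r: "ball p (2*r) \<subseteq> U" "r > 0" and q: "q \<in> ball p r"
  shows "cpd i f q = integral {0..1} (\<lambda>t. f (q + axis i (circlepath 0 (r/2) t)) / circlepath 0 (r/2) t)"
  by (rule cpd_Cauchy_integral[OF f]) (use r q in \<open>auto intro!: ball_axis_subset[of p r]\<close>)

lemma continuous_on_Cauchy_integrand:
  assumes f: "continuous_on U f" and r: "ball p (2*r) \<subseteq> U" "r > 0"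
  shows "continuous_on (ball p r \<times> cbox 0 1) (\<lambda>(q, t). f (q + axis i (circlepath 0 (r/2) t)) / circlepath 0 (r/2) t)"
proof -
  have "continuous_on (ball p r \<times> cbox 0 1) (\<lambda>x. f (fst x + axis i (circlepath 0 (r/2) (snd x))))"
    using f by (rule continuous_on_compose2) (use r in \<open>auto intro!: ball_axis_subset[of p r] continuous_intros
         continuous_on_compose2[OF continuous_on_circlepath] simp: circlepath norm_mult\<close>)
  then show ?thesis
    unfolding case_prod_beta
    by (intro continuous_intros continuous_on_compose2[OF continuous_on_circlepath]) (use r in \<open>auto simp: circlepath\<close>)
qed

lemma cpd_continuous:
  assumes U: "open U" and f: "partially_hol_on U f"
  shows "continuous_on U (cpd i f)"
proof (rule continuous_at_imp_continuous_on, rule ballI)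
  fix p assume "p \<in> U"
  then obtain e where e: "e > 0" "ball p e \<subseteq> U"
    using U openE by blast
  define r where "r = e/2"
  have r: "ball p (2*r) \<subseteq> U" "r > 0" using e by (auto simp: r_def)
  have "continuous_on (ball p r) (\<lambda>q. integral (cbox 0 1) (\<lambda>t. f (q + axis i (circlepath 0 (r/2) t)) / circlepath 0 (r/2) t))"
    using f r by (intro integral_continuous_on_param continuous_on_Cauchy_integrand[of U]) (auto simp: partially_hol_on_def)
  then have "continuous_on (ball p r) (cpd i f)"
    by (rule continuous_on_eq) (simp add: cpd_Cauchy_integral_ball[OF f r])
  then show "isCont (cpd i f) p"
    using r by (simp add: continuous_on_eq_continuous_at)
qed

text \<open>Cauchy's integral for \<open>cpd j f\<close> is differentiated under the integral sign
  in direction i. The result is at the same time Cauchy's integral for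
  \<open>cpd j (cpd i f)\<close>, so this yields both the existence of second derivatives and their
  symmetry.\<close>

lemma cpd_cpd_DERIV:
  assumes U: "open U" and f: "partially_hol_on U f" and r: "ball p (2*r) \<subseteq> U" "r > 0"
  shows "((\<lambda>s. cpd j f (p + axis i s)) has_field_derivative
    integral {0..1} (\<lambda>t. cpd i f (p + axis j (circlepath 0 (r/2) t)) / circlepath 0 (r/2) t)) (at 0)"
proof -
  let ?F = "\<lambda>f s t. f (p + axis i s + axis j (circlepath 0 (r/2) t)) / circlepath 0 (r/2) t"
  have inb: "p + axis i s \<in> ball p r" if "s \<in> ball 0 r" for s
    using that by (simp add: dist_norm norm_axis)
  have inU: "p + axis i s + axis j (circlepath 0 (r/2) t) \<in> U" if "s \<in> ball 0 r" for s t
    by (rule ball_axis_subset[OF r inb[OF that]]) (use r in \<open>simp add: circlepath norm_mult\<close>)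
  have cont: "continuous_on (ball 0 r \<times> cbox 0 1) (\<lambda>(s, t). ?F g s t)" if "continuous_on U g" for g
  proof -
    have "continuous_on (ball 0 r \<times> cbox 0 1) ((\<lambda>(q, t). g (q + axis j (circlepath 0 (r/2) t)) / circlepath 0 (r/2) t) \<circ> (\<lambda>(s, t). (p + axis i s, t)))"
      by (intro continuous_on_compose continuous_on_subset[OF continuous_on_Cauchy_integrand[OF that r]])
         (use inb in \<open>auto simp: case_prod_beta intro!: continuous_intros\<close>)
    then show ?thesis by (simp add: o_def case_prod_beta)
  qed
  have "((\<lambda>s. integral (cbox 0 1) (?F f s)) has_field_derivative integral (cbox 0 1) (?F (cpd i f) 0)) (at 0 within ball 0 r)"
  proof (rule leibniz_rule_field_derivative[where f="?F f" and fx="?F (cpd i f)"])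
    fix s :: complex and t :: real assume s: "s \<in> ball 0 r"
    let ?c = "circlepath 0 (r/2) t"
    have "((\<lambda>s. f (p + axis j ?c + axis i s)) has_field_derivative cpd i f (p + axis j ?c + axis i s)) (at s)"
      by (rule slice_has_derivative[OF f]) (use inU[OF s, of t] in \<open>simp add: add_ac\<close>)
    then have "((\<lambda>s. f (p + axis j ?c + axis i s) / ?c) has_field_derivative cpd i f (p + axis j ?c + axis i s) / ?c) (at s)"
      by (rule DERIV_cdivide)
    then show "((\<lambda>s. ?F f s t) has_field_derivative ?F (cpd i f) s t) (at s within ball 0 r)"
      by (simp add: add_ac has_field_derivative_at_within)
  next
    fix s :: complex assume s: "s \<in> ball 0 r"
    have "continuous_on (cbox 0 1) ((\<lambda>(s, t). ?F f s t) \<circ> Pair s)"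
      using s f by (intro continuous_on_compose continuous_on_subset[OF cont]) (auto intro!: continuous_intros simp: partially_hol_on_def)
    then show "?F f s integrable_on cbox 0 1"
      by (intro integrable_continuous) (simp add: o_def)
  next
    show "continuous_on (ball 0 r \<times> cbox 0 1) (\<lambda>(s, t). ?F (cpd i f) s t)"
      by (rule cont[OF cpd_continuous[OF U f]])
  qed (use r in \<open>simp_all add: convex_ball\<close>)
  moreover have "at 0 within ball 0 r = at (0::complex)"
    by (rule at_within_open) (use r in simp_all)
  ultimately have "((\<lambda>s. integral (cbox 0 1) (?F f s)) has_field_derivative integral (cbox 0 1) (?F (cpd i f) 0)) (at 0)"
    by (simp only:)
  then have "((\<lambda>s. cpd j f (p + axis i s)) has_field_derivative integral (cbox 0 1) (?F (cpd i f) 0)) (at 0)"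
    by (rule has_field_derivative_transform_within_open[of _ _ _ "ball 0 r"])
       (use r inb in \<open>auto simp: cpd_Cauchy_integral_ball[OF f r]\<close>)
  then show ?thesis by (simp only: axis_zero add_0_right box_real)
qed

lemma partially_hol_on_cpd:
  assumes U: "open U" and f: "partially_hol_on U f"
  shows "partially_hol_on U (cpd j f)"
proof -
  have "(\<lambda>s. cpd j f (p + axis i s)) field_differentiable at 0" if p: "p \<in> U" for i p
  proof -
    obtain e where e: "e > 0" "ball p e \<subseteq> U"
      using U p openE by blast
    then show ?thesis
      unfolding field_differentiable_def by (intro exI) (rule cpd_cpd_DERIV[OF U f, of p "e/2"], auto)
  qed
  then show ?thesis
    using cpd_continuous[OF U f] by (simp add: partially_hol_on_def)
qed

lemma cpd_commute:
  assumes U: "open U" and f: "partially_hol_on U f" and p: "p \<in> U"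
  shows "cpd i (cpd j f) p = cpd j (cpd i f) p"
proof -
  obtain e where e: "e > 0" "ball p e \<subseteq> U"
    using U p openE by blast
  then have r: "ball p (2*(e/2)) \<subseteq> U" "e/2 > 0" by auto
  have "cpd i (cpd j f) p = integral {0..1} (\<lambda>t. cpd i f (p + axis j (circlepath 0 (e/2/2) t)) / circlepath 0 (e/2/2) t)"
    unfolding cpd_def[of i "cpd j f"] by (rule DERIV_imp_deriv[OF cpd_cpd_DERIV[OF U f r]])
  also have "\<dots> = cpd j (cpd i f) p"
    by (rule cpd_Cauchy_integral_ball[symmetric, OF partially_hol_on_cpd[OF U f] r]) (use e in auto)
  finally show ?thesis .
qed

text \<open>\<open>partially_hol_on\<close> is the hypothesis of Osgood's lemma. The class is closed
  under \<open>cpd\<close>, so one derivative in each variable gives all of them by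
  induction.\<close>

lemma C_inf_on_iff_partially_hol_on:
  assumes "open U"
  shows "C_inf_on U f \<longleftrightarrow> partially_hol_on U f"
proof
  assume "C_inf_on U f"
  then have "C_k_on (Suc 0) U f" unfolding C_inf_on_def by blast
  then show "partially_hol_on U f" by (simp add: partially_hol_on_def)
next
  have "C_k_on k U f" if "partially_hol_on U f" for k f
    using that
  proof (induction k arbitrary: f)
    case 0
    then show ?case by (simp add: partially_hol_on_def)
  next
    case (Suc k)
    then show ?case using partially_hol_on_cpd[OF assms] by (simp add: partially_hol_on_def)
  qed
  then show "partially_hol_on U f \<Longrightarrow> C_inf_on U f" by (simp add: C_inf_on_def)
qed

section \<open>Complex-linear total derivatives\<close>

definition dird :: "(complex^2 \<Rightarrow> complex) \<Rightarrow> complex^2 \<Rightarrow> complex^2 \<Rightarrow> complex" where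
  "dird f p h = cpd 1 f p * h $ 1 + cpd 2 f p * h $ 2"

text \<open>Prescribing \<open>dird\<close> as the total derivative makes it complex-linear, whereas
  \<open>has_derivative\<close> alone guarantees real linearity. The total derivative is what the
  chain rule and the inverse function theorem work with.\<close>

definition hol2_on :: "(complex^2) set \<Rightarrow> (complex^2 \<Rightarrow> complex) \<Rightarrow> bool" where
  "hol2_on U f \<longleftrightarrow> (\<forall>p\<in>U. (f has_derivative dird f p) (at p))"

text \<open>Complex homogeneity of D is a separate hypothesis because a Frechet derivative is only
  real-linear; with it, the restriction to a complex line is complex differentiable.\<close>

lemma has_derivative_slice:
  fixes f :: "complex^2 \<Rightarrow> complex"
  assumes D: "(f has_derivative D) (at p)" and lin: "\<And>c h. D (c *s h) = c * D h"
  shows "((\<lambda>t. f (p + t *s h)) has_field_derivative D h) (at 0)"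
proof -
  have bl: "bounded_linear (\<lambda>t::complex. t *s h)"
    by (rule bounded_linear_intro[where K="norm h"])
      (auto simp: vec.scale_left_distrib vec_eq_iff norm_vec_def L2_set_def norm_mult power_mult_distrib
        sum_distrib_left[symmetric] real_sqrt_mult)
  have "((\<lambda>t. p + t *s h) has_derivative (\<lambda>t. 0 + t *s h)) (at 0)"
    by (intro has_derivative_add has_derivative_const bounded_linear.has_derivative[OF bl] has_derivative_ident)
  then have "((\<lambda>t. f (p + t *s h)) has_derivative (\<lambda>t. D (0 + t *s h))) (at 0)"
    by (rule has_derivative_compose) (use D in simp)
  moreover have "(\<lambda>t. D (0 + t *s h)) = (*) (D h)"
    by (simp add: lin fun_eq_iff)
  ultimately show ?thesis by (simp only: has_field_derivative_def)
qed

lemma axis_eq_scale: "axis i t = t *s axis i (1::complex)"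
  by (simp add: axis_mult[symmetric])

lemma dird_eqI:
  assumes D: "(f has_derivative D) (at p)" and lin: "\<And>c h. D (c *s h) = c * D h"
  shows "dird f p = D" "(f has_derivative dird f p) (at p)"
proof -
  have "cpd i f p = D (axis i 1)" for i
    unfolding cpd_def using DERIV_imp_deriv[OF has_derivative_slice[OF D lin, of "axis i 1"]]
    by (simp add: axis_eq_scale[symmetric])
  moreover have "D h = h$1 * D (axis 1 1) + h$2 * D (axis 2 1)" for h
  proof -
    have "D h = D (axis 1 (h$1) + axis 2 (h$2))" by simp
    also have "\<dots> = D (axis 1 (h$1)) + D (axis 2 (h$2))"
      by (rule linear_add[OF has_derivative_linear[OF D]])
    finally show ?thesis by (simp add: axis_eq_scale[of _ "h$_"] lin)
  qed
  ultimately have "dird f p h = D h" for h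
    unfolding dird_def by (metis mult.commute)
  then show "dird f p = D" by (rule ext)
  then show "(f has_derivative dird f p) (at p)" using D by simp
qed

lemma dird_scale: "dird f p (c *s h) = c * dird f p h"
  by (simp add: dird_def algebra_simps)

lemma dird_add: "dird f p (h + k) = dird f p h + dird f p k"
  and dird_diff: "dird f p (h - k) = dird f p h - dird f p k"
  by (simp_all add: dird_def algebra_simps)

lemma hol2_onI:
  assumes "\<And>p. p \<in> U \<Longrightarrow> \<exists>D. (f has_derivative D) (at p) \<and> (\<forall>c h. D (c *s h) = c * D h)"
  shows "hol2_on U f"
proof (unfold hol2_on_def, rule ballI)
  fix p assume "p \<in> U"
  then obtain D where "(f has_derivative D) (at p)" "\<And>c h. D (c *s h) = c * D h"
    using assms by blast
  then show "(f has_derivative dird f p) (at p)" by (rule dird_eqI(2))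
qed

lemma hol2_on_subset: "hol2_on U f \<Longrightarrow> V \<subseteq> U \<Longrightarrow> hol2_on V f"
  by (auto simp: hol2_on_def)

lemma hol2_onD: "hol2_on U f \<Longrightarrow> p \<in> U \<Longrightarrow> (f has_derivative dird f p) (at p)"
  by (auto simp: hol2_on_def)

lemma hol2_on_continuous_on: "hol2_on U f \<Longrightarrow> continuous_on U f"
  by (meson continuous_at_imp_continuous_on has_derivative_continuous hol2_onD)

lemma hol2_on_imp_partially_hol_on:
  assumes "hol2_on U f"
  shows "partially_hol_on U f"
proof -
  have "(\<lambda>t. f (p + axis i t)) field_differentiable at 0" if "p \<in> U" for i p
    using has_derivative_slice[OF hol2_onD[OF assms that] dird_scale, of "axis i 1"]
    by (simp add: axis_eq_scale[symmetric] field_differentiable_def) blast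
  then show ?thesis using hol2_on_continuous_on[OF assms] by (simp add: partially_hol_on_def)
qed

text \<open>Osgood's lemma. Cauchy's formula makes the partial derivatives continuous, and one
  partial derivative together with a continuous second one gives a total derivative. That criterion
  concerns functions on a product, hence the passage through pairs and back.\<close>

lemma partially_hol_on_imp_hol2_on:
  assumes U: "open U" and f: "partially_hol_on U f"
  shows "hol2_on U f"
proof (unfold hol2_on_def, rule ballI)
  fix p assume "p \<in> U"
  then obtain e where e: "e > 0" "ball p e \<subseteq> U"
    using U openE by blast
  define r where "r = e/2"
  let ?g = "\<lambda>x y. f (axis 1 x + axis 2 y)"
  let ?X = "ball (p$1) r" and ?Y = "ball (p$2) r"
  have inU: "(axis 1 x + axis 2 y :: complex^2) \<in> U" if "x \<in> ?X" "y \<in> ?Y" for x y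
  proof -
    have "norm ((axis 1 x + axis 2 y :: complex^2) - (axis 1 (p$1) + axis 2 (p$2))) = norm (axis 1 (x - p$1) + axis 2 (y - p$2) :: complex^2)"
      by (rule arg_cong[where f=norm]) (simp add: vec_eq_iff axis_def)
    also have "\<dots> \<le> norm (x - p$1) + norm (y - p$2)"
      using norm_triangle_ineq[of "axis 1 (x - p$1)" "axis 2 (y - p$2) :: complex^2"] by (simp add: norm_axis)
    also have "\<dots> < e" using that by (simp add: r_def dist_norm norm_minus_commute)
    finally show ?thesis using e by (auto simp: dist_norm norm_minus_commute)
  qed
  have "((\<lambda>(x, y). ?g x y) has_derivative
      (\<lambda>(tx, ty). cpd 1 f p * tx + blinfun_mult_right (cpd 2 f (axis 1 (p$1) + axis 2 (p$2))) ty))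
      (at (p$1, p$2) within ?X \<times> ?Y)"
  proof (rule has_derivative_partialsI)
    have "((\<lambda>x. f (axis 2 (p$2) + axis 1 x)) has_field_derivative cpd 1 f (axis 2 (p$2) + axis 1 (p$1))) (at (p$1))"
      by (rule slice_has_derivative[OF f]) (use \<open>p \<in> U\<close> in \<open>simp\<close>)
    then show "((\<lambda>x. ?g x (p$2)) has_derivative (*) (cpd 1 f p)) (at (p$1) within ?X)"
      by (simp add: add.commute[of "axis 2 _"] has_field_derivative_def has_derivative_at_withinI)
  next
    fix x y assume "x \<in> ?X" "y \<in> ?Y"
    then have "((\<lambda>y. f (axis 1 x + axis 2 y)) has_field_derivative cpd 2 f (axis 1 x + axis 2 y)) (at y)"
      by (intro slice_has_derivative[OF f] inU)
    then show "(?g x has_derivative blinfun_apply (blinfun_mult_right (cpd 2 f (axis 1 x + axis 2 y)))) (at y within ?Y)"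
      by (simp add: has_field_derivative_def has_derivative_at_withinI)
  next
    have "continuous_on (?X \<times> ?Y) (\<lambda>x. cpd 2 f (axis 1 (fst x) + axis 2 (snd x)))"
      by (rule continuous_on_compose2[OF cpd_continuous[OF U f]]) (auto intro!: continuous_intros inU)
    then have "continuous_on (?X \<times> ?Y) (\<lambda>x. blinfun_mult_right (cpd 2 f (axis 1 (fst x) + axis 2 (snd x))))"
      by (intro continuous_intros)
    then show "continuous (at (p $ 1, p $ 2) within ?X \<times> ?Y) (\<lambda>(x, y). blinfun_mult_right (cpd 2 f (axis 1 x + axis 2 y)))"
      using e unfolding case_prod_beta continuous_on_eq_continuous_within by (auto simp: r_def)
  qed (use e in \<open>auto simp: r_def\<close>)
  then have *: "((\<lambda>(x, y). ?g x y) has_derivative (\<lambda>(tx, ty). cpd 1 f p * tx + cpd 2 f p * ty)) (at (p$1, p$2))"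
    using e
    by (subst (asm) at_within_open) (auto simp: r_def open_Times)
  have "((\<lambda>q. (q$1, q$2)) has_derivative (\<lambda>q. (q$1, q$2))) (at p)"
    by (intro has_derivative_Pair bounded_linear.has_derivative[OF bounded_linear_vec_nth] has_derivative_ident)
  from has_derivative_compose[OF this *]
  show "(f has_derivative dird f p) (at p)"
    by (simp add: dird_def[abs_def])
qed

lemma C_inf_on_iff_hol2_on: "open U \<Longrightarrow> C_inf_on U f \<longleftrightarrow> hol2_on U f"
  using C_inf_on_iff_partially_hol_on partially_hol_on_imp_hol2_on hol2_on_imp_partially_hol_on by blast

text \<open>A single derivative certificate gives both holomorphy and the value of
  \<open>dird\<close>; the calculus rules below come in such pairs.\<close>

lemma hol2_on_has_derivative_imp:
  assumes "\<And>p. p \<in> U \<Longrightarrow> (f has_derivative D p) (at p)" and "\<And>p c h. p \<in> U \<Longrightarrow> D p (c *s h) = c * D p h"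
  shows "hol2_on U f" "p \<in> U \<Longrightarrow> dird f p h = D p h"
proof -
  show "hol2_on U f" by (rule hol2_onI) (use assms in blast)
  show "p \<in> U \<Longrightarrow> dird f p h = D p h" using dird_eqI(1)[of f "D p" p] assms by simp
qed

section \<open>Calculus rules\<close>

lemma hol2_on_const: "hol2_on U (\<lambda>_. c)"
  and dird_const: "dird (\<lambda>_. c) p h = 0"
  using hol2_on_has_derivative_imp[of UNIV "\<lambda>_. c" "\<lambda>_ _. 0"]
    hol2_on_subset[of UNIV "\<lambda>_. c" U] by auto

lemma hol2_on_coord: "hol2_on U (\<lambda>q. q $ i)"
  and dird_coord: "dird (\<lambda>q. q $ i) p h = h $ i"
  using hol2_on_has_derivative_imp[of UNIV "\<lambda>q. q $ i" "\<lambda>_ h. h $ i"]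
    hol2_on_subset[of UNIV "\<lambda>q. q $ i" U] bounded_linear.has_derivative[OF bounded_linear_vec_nth has_derivative_ident]
  by auto

lemma hol2_on_add: "hol2_on U f \<Longrightarrow> hol2_on U g \<Longrightarrow> hol2_on U (\<lambda>q. f q + g q)"
  and dird_add_fun: "hol2_on U f \<Longrightarrow> hol2_on U g \<Longrightarrow> p \<in> U \<Longrightarrow> dird (\<lambda>q. f q + g q) p h = dird f p h + dird g p h"
  using hol2_on_has_derivative_imp[of U "\<lambda>q. f q + g q" "\<lambda>p h. dird f p h + dird g p h"]
  by (auto intro!: has_derivative_add hol2_onD simp: dird_scale algebra_simps)

lemma hol2_on_diff: "hol2_on U f \<Longrightarrow> hol2_on U g \<Longrightarrow> hol2_on U (\<lambda>q. f q - g q)"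
  and dird_diff_fun: "hol2_on U f \<Longrightarrow> hol2_on U g \<Longrightarrow> p \<in> U \<Longrightarrow> dird (\<lambda>q. f q - g q) p h = dird f p h - dird g p h"
  using hol2_on_has_derivative_imp[of U "\<lambda>q. f q - g q" "\<lambda>p h. dird f p h - dird g p h"]
  by (auto intro!: has_derivative_diff hol2_onD simp: dird_scale algebra_simps)

lemma hol2_on_mult: "hol2_on U f \<Longrightarrow> hol2_on U g \<Longrightarrow> hol2_on U (\<lambda>q. f q * g q)"
  and dird_mult_fun: "hol2_on U f \<Longrightarrow> hol2_on U g \<Longrightarrow> p \<in> U \<Longrightarrow>
    dird (\<lambda>q. f q * g q) p h = f p * dird g p h + dird f p h * g p"
proof -
  assume f: "hol2_on U f" and g: "hol2_on U g"
  have "((\<lambda>q. f q * g q) has_derivative (\<lambda>h. f p * dird g p h + dird f p h * g p)) (at p)" if "p \<in> U" for p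
    by (intro has_derivative_mult hol2_onD[OF f that] hol2_onD[OF g that])
  note * = hol2_on_has_derivative_imp[OF this]
  show "hol2_on U (\<lambda>q. f q * g q)"
    by (rule *) (simp_all add: dird_scale algebra_simps)
  show "p \<in> U \<Longrightarrow> dird (\<lambda>q. f q * g q) p h = f p * dird g p h + dird f p h * g p"
    by (rule *) (simp_all add: dird_scale algebra_simps)
qed

lemma hol2_on_inverse:
  assumes f: "hol2_on U f" and nz: "\<And>p. p \<in> U \<Longrightarrow> f p \<noteq> 0"
  shows "hol2_on U (\<lambda>q. inverse (f q))"
  by (rule hol2_on_has_derivative_imp(1)[OF Deriv.has_derivative_inverse[OF nz hol2_onD[OF f]]])
     (auto simp: dird_scale algebra_simps)

lemma hol2_on_divide:
  assumes f: "hol2_on U f" and g: "hol2_on U g" and nz: "\<And>p. p \<in> U \<Longrightarrow> g p \<noteq> 0"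
  shows "hol2_on U (\<lambda>q. f q / g q)"
  unfolding divide_inverse by (intro hol2_on_mult f hol2_on_inverse g nz)

lemma hol2_on_power: "hol2_on U f \<Longrightarrow> hol2_on U (\<lambda>q. f q ^ n)"
  by (induction n) (auto intro: hol2_on_const hol2_on_mult)

lemma hol2_on_sum: "(\<And>i. i \<in> I \<Longrightarrow> hol2_on U (F i)) \<Longrightarrow> hol2_on U (\<lambda>q. \<Sum>i\<in>I. F i q)"
  by (induction I rule: infinite_finite_induct) (auto intro: hol2_on_const hol2_on_add)

lemma dird_sum:
  "(\<And>i. i \<in> I \<Longrightarrow> hol2_on U (F i)) \<Longrightarrow> p \<in> U \<Longrightarrow> dird (\<lambda>q. \<Sum>i\<in>I. F i q) p h = (\<Sum>i\<in>I. dird (F i) p h)"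
  by (induction I rule: infinite_finite_induct) (auto simp: dird_const dird_add_fun[of U] hol2_on_sum)

lemma dird_power:
  assumes "hol2_on U f" "p \<in> U"
  shows "dird (\<lambda>q. f q ^ n) p h = of_nat n * f p ^ (n - 1) * dird f p h"
proof (induction n)
  case (Suc n)
  have "dird (\<lambda>q. f q ^ Suc n) p h = f p * dird (\<lambda>q. f q ^ n) p h + dird f p h * f p ^ n"
    using dird_mult_fun[OF assms(1) hol2_on_power[OF assms(1)] assms(2)] by simp
  then show ?case using Suc by (cases n) (auto simp: algebra_simps)
qed (simp add: dird_const)

lemma dird_cong:
  assumes "open U" "hol2_on U f" "\<And>q. q \<in> U \<Longrightarrow> f q = g q" "p \<in> U"
  shows "dird g p = dird f p"
  by (rule dird_eqI(1)[OF has_derivative_transform_within_open[OF hol2_onD[OF assms(2,4)] assms(1,4,3)] dird_scale])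

lemma cpd_eq_dird: "cpd i f p = dird f p (axis i 1)"
  by (simp add: dird_def axis_def forall_2) (metis exhaust_2)

lemma cjac_mult_nth: "(cjac F p *v h) $ i = dird (\<lambda>q. F q $ i) p h"
  by (simp add: matrix_vector_mult_def sum_2 cjac_def dird_def)

section \<open>Holomorphic maps and Lie brackets\<close>

definition hol2_map_on :: "(complex^2) set \<Rightarrow> (complex^2 \<Rightarrow> complex^2) \<Rightarrow> bool" where
  "hol2_map_on U F \<longleftrightarrow> (\<forall>i. hol2_on U (\<lambda>p. F p $ i))"

lemma C_inf_map_on_iff: "open U \<Longrightarrow> C_inf_map_on U F \<longleftrightarrow> hol2_map_on U F"
  by (simp add: C_inf_map_on_def hol2_map_on_def C_inf_on_iff_hol2_on)

lemma hol2_map_on_subset: "hol2_map_on U F \<Longrightarrow> V \<subseteq> U \<Longrightarrow> hol2_map_on V F"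
  unfolding hol2_map_on_def using hol2_on_subset by blast

lemma hol2_map_on_has_derivative:
  assumes F: "hol2_map_on U F" and p: "p \<in> U"
  shows "(F has_derivative (\<lambda>h. cjac F p *v h)) (at p)"
proof -
  have "((\<lambda>q. axis 1 (F q $ 1) + axis 2 (F q $ 2)) has_derivative
     (\<lambda>h. axis 1 (dird (\<lambda>q. F q $ 1) p h) + axis 2 (dird (\<lambda>q. F q $ 2) p h) :: complex^2)) (at p)"
    using F p by (intro has_derivative_add bounded_linear.has_derivative[OF bounded_linear_axis] hol2_onD[of U])
      (auto simp: hol2_map_on_def)
  moreover have "axis 1 (dird (\<lambda>q. F q $ 1) p h) + axis 2 (dird (\<lambda>q. F q $ 2) p h) = cjac F p *v h" for h
    by (simp add: cjac_mult_nth[symmetric])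
  ultimately show ?thesis by (simp only: axis_add_axis)
qed

lemma hol2_map_on_continuous_on: "hol2_map_on U F \<Longrightarrow> continuous_on U F"
  by (meson continuous_at_imp_continuous_on has_derivative_continuous hol2_map_on_has_derivative)

lemma matrix_vector_mult_scale: "A *v (c *s h) = c *s (A *v (h::'a::comm_ring_1^'n))"
  by (simp add: vec_eq_iff matrix_vector_mult_def sum_distrib_left mult_ac)

lemma hol2_on_compose:
  assumes f: "hol2_on U f" and F: "hol2_map_on V F" and "F ` V \<subseteq> U"
  shows "hol2_on V (\<lambda>q. f (F q))"
    and dird_compose: "q \<in> V \<Longrightarrow> dird (\<lambda>q. f (F q)) q h = dird f (F q) (cjac F q *v h)"
  using hol2_on_has_derivative_imp[of V "\<lambda>q. f (F q)" "\<lambda>q h. dird f (F q) (cjac F q *v h)"]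
    has_derivative_compose[OF hol2_map_on_has_derivative[OF F] hol2_onD[OF f]] assms(3)
  by (auto simp: matrix_vector_mult_scale dird_scale image_subset_iff)

lemma hol2_on_cpd: "open U \<Longrightarrow> hol2_on U f \<Longrightarrow> hol2_on U (cpd i f)"
  using partially_hol_on_cpd partially_hol_on_imp_hol2_on hol2_on_imp_partially_hol_on by blast

lemma hol2_on_dird:
  assumes "open U" "hol2_on U f" "hol2_map_on U X"
  shows "hol2_on U (\<lambda>q. dird f q (X q))"
  unfolding dird_def by (intro hol2_on_add hol2_on_mult hol2_on_cpd) (use assms in \<open>auto simp: hol2_map_on_def\<close>)

lemma dird_dird:
  assumes "open U" "hol2_on U f" "hol2_map_on U Y" "p \<in> U"
  shows "dird (\<lambda>q. dird f q (Y q)) p h =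
    dird (cpd 1 f) p h * Y p $ 1 + dird (cpd 2 f) p h * Y p $ 2 + dird f p (cjac Y p *v h)"
proof -
  have Y: "hol2_on U (\<lambda>q. Y q $ i)" for i using assms by (auto simp: hol2_map_on_def)
  note c = hol2_on_cpd[OF assms(1,2)]
  have "dird (\<lambda>q. dird f q (Y q)) p h = dird (\<lambda>q. cpd 1 f q * Y q $ 1 + cpd 2 f q * Y q $ 2) p h"
    by (simp only: dird_def[of f])
  also have "\<dots> = cpd 1 f p * dird (\<lambda>q. Y q $ 1) p h + dird (cpd 1 f) p h * Y p $ 1 +
      (cpd 2 f p * dird (\<lambda>q. Y q $ 2) p h + dird (cpd 2 f) p h * Y p $ 2)"
    by (simp only: dird_add_fun[OF hol2_on_mult[OF c Y] hol2_on_mult[OF c Y] assms(4)] dird_mult_fun[OF c Y assms(4)])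
  finally show ?thesis by (simp add: dird_def[of f] cjac_mult_nth)
qed

text \<open>The bracket acts on functions as the commutator of two derivations: the second-order
  terms cancel because mixed partial derivatives agree.\<close>

lemma dird_lie_bracket:
  assumes "open U" "hol2_on U f" "hol2_map_on U X" "hol2_map_on U Y" "p \<in> U"
  shows "dird f p (lie_bracket X Y p) = dird (\<lambda>q. dird f q (Y q)) p (X p) - dird (\<lambda>q. dird f q (X q)) p (Y p)"
proof -
  have "cpd 1 (cpd 2 f) p = cpd 2 (cpd 1 f) p"
    using cpd_commute[OF assms(1) hol2_on_imp_partially_hol_on[OF assms(2)] assms(5)] .
  then show ?thesis
    by (simp add: dird_dird[OF assms(1,2)] assms lie_bracket_def dird_diff) (simp add: dird_def algebra_simps)
qed

lemma lie_bracket_nth: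
  "lie_bracket X Y p $ i = dird (\<lambda>q. Y q $ i) p (X p) - dird (\<lambda>q. X q $ i) p (Y p)"
  by (simp add: lie_bracket_def cjac_mult_nth)

text \<open>In components, a bracket being differentiated expands by \<open>lie_bracket_nth\<close>,
  and a bracket serving as direction expands by \<open>dird_lie_bracket\<close>. Everything becomes
  words of two derivations applied to a component, and these words cancel.\<close>

lemma Jacobi_at:
  assumes U: "open U" and X: "hol2_map_on U X" and Y: "hol2_map_on U Y" and Z: "hol2_map_on U Z" and p: "p \<in> U"
  shows "lie_bracket Z (lie_bracket X Y) p = lie_bracket (lie_bracket Z X) Y p + lie_bracket X (lie_bracket Z Y) p"
proof -
  have c: "hol2_on U (\<lambda>q. V q $ i)" if "hol2_map_on U V" for V i
    using that by (auto simp: hol2_map_on_def)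
  have b: "lie_bracket V W q $ i = dird (\<lambda>q. W q $ i) q (V q) - dird (\<lambda>q. V q $ i) q (W q)" for V W q i
    by (rule lie_bracket_nth)
  note d = dird_diff_fun[OF hol2_on_dird[OF U c] hol2_on_dird[OF U c] p]
  note l = dird_lie_bracket[OF U c _ _ p]
  have "lie_bracket Z (lie_bracket X Y) p $ i = (lie_bracket (lie_bracket Z X) Y p + lie_bracket X (lie_bracket Z Y) p) $ i" for i
    by (simp add: b d l X Y Z del: dird_diff)
  then show ?thesis by (simp add: vec_eq_iff)
qed

section \<open>Identity theorem, Cauchy estimates and inverse functions\<close>

lemma hol2_on_line_holomorphic:
  assumes f: "hol2_on B f" and B: "open B"
  shows "(\<lambda>t. f (s + t *s h)) holomorphic_on {t. s + t *s h \<in> B}" "open {t. s + t *s h \<in> B}"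
proof -
  have c: "continuous_on UNIV (\<lambda>t. s + t *s h)"
    by (intro continuous_intros continuous_on_vec_lambda) (simp add: vector_scalar_mult_def, intro continuous_intros)
  then show o: "open {t. s + t *s h \<in> B}"
    using open_vimage[OF B c] by (simp add: vimage_def)
  have "(\<lambda>t. f (s + t *s h)) field_differentiable at t" if "s + t *s h \<in> B" for t
  proof -
    have "((\<lambda>u. f (s + t *s h + u *s h)) has_field_derivative dird f (s + t *s h) h) (at 0)"
      by (rule has_derivative_slice[OF hol2_onD[OF f that] dird_scale])
    then have "((\<lambda>u. f (s + (u + t) *s h)) has_field_derivative dird f (s + t *s h) h) (at 0)"
      by (simp add: vec.scale_left_distrib add_ac)
    then show ?thesis
      using DERIV_shift[of "\<lambda>t. f (s + t *s h)" _ 0 t] unfolding field_differentiable_def by auto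
  qed
  then show "(\<lambda>t. f (s + t *s h)) holomorphic_on {t. s + t *s h \<in> B}"
    unfolding holomorphic_on_def using field_differentiable_at_within by blast
qed

text \<open>On the complex line through s and q the admissible parameters form an open convex set,
  and f vanishes for parameters near 0. The one-variable identity theorem then reaches parameter 1,
  which is q.\<close>

lemma hol2_on_convex_zero:
  assumes f: "hol2_on B f" and B: "open B" "convex B" and S: "open S" "S \<subseteq> B" "s \<in> S"
    and z: "\<And>q. q \<in> S \<Longrightarrow> f q = 0" and q: "q \<in> B"
  shows "f q = 0"
proof -
  define h where "h = q - s"
  let ?T = "{t. s + t *s h \<in> B}"
  have T: "(\<lambda>t. f (s + t *s h)) holomorphic_on ?T" "open ?T"
    using hol2_on_line_holomorphic[OF f B(1)] by auto
  have "open {t. s + t *s h \<in> S}"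
    by (rule hol2_on_line_holomorphic(2)[OF hol2_on_const S(1)])
  moreover have "0 \<in> {t. s + t *s h \<in> S}" using S by simp
  moreover have "convex ?T"
  proof (rule convexI)
    fix x y :: complex and u v :: real assume a: "x \<in> ?T" "y \<in> ?T" "0 \<le> u" "0 \<le> v" "u + v = 1"
    have "s + (u *\<^sub>R x + v *\<^sub>R y) *s h = u *\<^sub>R (s + x *s h) + v *\<^sub>R (s + y *s h)"
    proof -
      have "v = 1 - u" using a(5) by simp
      then show ?thesis by (simp add: vec_eq_iff) (simp add: scaleR_conv_of_real algebra_simps)
    qed
    then show "u *\<^sub>R x + v *\<^sub>R y \<in> ?T"
      using a B(2) by (auto simp: convex_def)
  qed
  moreover have "{t. s + t *s h \<in> S} \<noteq> {}"
    using calculation(2) by blast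
  ultimately have "f (s + 1 *s h) = 0"
    by (intro analytic_continuation_open[of "{t. s + t *s h \<in> S}" ?T "\<lambda>t. f (s + t *s h)" "\<lambda>_. 0" 1, OF _ T(2) _ _ _ T(1)])
      (use S(2) q z in \<open>auto intro: convex_connected simp: h_def\<close>)
  then show ?thesis by (simp add: h_def)
qed

text \<open>The interior of the zero set is open and closed in C: a ball around a limit point meets
  it, and the convex case spreads the zeros over that ball.\<close>

lemma hol2_on_identity:
  assumes f: "hol2_on C f" and C: "open C" "connected C" and S: "open S" "S \<subseteq> C" "S \<noteq> {}"
    and z: "\<And>q. q \<in> S \<Longrightarrow> f q = 0" and q: "q \<in> C"
  shows "f q = 0"
proof -
  define Z where "Z = C \<inter> interior {q. f q = 0}"
  have "open Z" using C by (simp add: Z_def open_Int)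
  moreover have "openin (top_of_set C) Z"
    unfolding Z_def by (simp add: openin_open_Int)
  moreover have "closedin (top_of_set C) Z"
  proof -
    have "x \<in> Z" if x: "x \<in> C" "x \<in> closure Z" for x
    proof -
      obtain e where e: "e > 0" "ball x e \<subseteq> C" using C(1) x(1) openE by blast
      have "ball x e \<inter> Z \<noteq> {}"
        using x(2) e(1) by (metis centre_in_ball open_ball open_Int_closure_eq_empty disjoint_iff)
      then obtain s where s: "s \<in> ball x e \<inter> Z" by blast
      have "f y = 0" if "y \<in> ball x e" for y
        by (rule hol2_on_convex_zero[of "ball x e" f "ball x e \<inter> Z" s])
           (use s that e \<open>open Z\<close> interior_subset[of "{q. f q = 0}"] in \<open>auto simp: Z_def intro: hol2_on_subset[OF f]\<close>)
      then have "x \<in> interior {q. f q = 0}" using e by (intro interiorI[of "ball x e"]) auto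
      then show ?thesis using x by (simp add: Z_def)
    qed
    then have "Z = C \<inter> closure Z" using closure_subset[of Z] by (auto simp: Z_def)
    then show ?thesis by (metis closed_closure closedin_closed_Int)
  qed
  moreover have "S \<subseteq> Z" using S z by (auto simp: Z_def intro: interiorI[of S])
  ultimately have "Z = C" using C(2) S(3) unfolding connected_clopen by blast
  then show ?thesis using q interior_subset[of "{q. f q = 0}"] by (auto simp: Z_def)
qed

section \<open>Polydiscs, Cauchy estimates and limits\<close>

definition polydisc :: "complex^2 \<Rightarrow> real \<Rightarrow> (complex^2) set" where
  "polydisc p r = {q. \<forall>i. dist (p $ i) (q $ i) < r}"

lemma open_polydisc: "open (polydisc p r)"
  unfolding polydisc_def forall_2 by (intro open_Collect_conj open_Collect_less continuous_intros)

lemma polydisc_mono: "r \<le> s \<Longrightarrow> polydisc p r \<subseteq> polydisc p s"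
  unfolding polydisc_def by (blast intro: less_le_trans)

lemma centre_in_polydisc: "r > 0 \<Longrightarrow> p \<in> polydisc p r"
  by (simp add: polydisc_def)

lemma polydisc_subset_ball: "polydisc p (r/2) \<subseteq> ball p r"
proof
  fix q assume q: "q \<in> polydisc p (r/2)"
  have "dist p q = L2_set (\<lambda>i. dist (p $ i) (q $ i)) UNIV" by (simp add: dist_vec_def)
  also have "\<dots> \<le> (\<Sum>i\<in>UNIV. dist (p $ i) (q $ i))" by (rule L2_set_le_sum) simp
  also have "\<dots> < r" using q by (simp add: sum_2 polydisc_def forall_2)
  finally show "q \<in> ball p r" by simp
qed

lemma polydisc_exhausts: "open U \<Longrightarrow> p \<in> U \<Longrightarrow> \<exists>r>0. polydisc p r \<subseteq> U"
  by (metis half_gt_zero openE polydisc_subset_ball subset_trans)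

lemma compact_closed_polydisc: "compact {q. \<forall>i. dist (p $ i) (q $ i) \<le> r}" for p :: "complex^2"
proof -
  have "{q. \<forall>i. dist (p $ i) (q $ i) \<le> r} \<subseteq> cball p (2*r)"
  proof
    fix q assume q: "q \<in> {q. \<forall>i. dist (p $ i) (q $ i) \<le> r}"
    have "dist p q = L2_set (\<lambda>i. dist (p $ i) (q $ i)) UNIV" by (simp add: dist_vec_def)
    also have "\<dots> \<le> (\<Sum>i\<in>UNIV. dist (p $ i) (q $ i))" by (rule L2_set_le_sum) simp
    also have "\<dots> \<le> 2*r" using q by (simp add: sum_2 forall_2)
    finally show "q \<in> cball p (2*r)" by simp
  qed
  moreover have "closed {q. \<forall>i. dist (p $ i) (q $ i) \<le> r}"
    unfolding forall_2 by (intro closed_Collect_conj closed_Collect_le continuous_intros)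
  ultimately show ?thesis using bounded_subset[OF bounded_cball] by (simp add: compact_eq_bounded_closed)
qed

text \<open>The one-variable Cauchy inequality is used on a disc of radius \<delta> parallel to an
  axis. That disc moves one coordinate by at most \<delta>, so reducing the polyradius by \<delta>
  keeps it inside.\<close>

lemma cpd_Cauchy_inequality:
  assumes f: "hol2_on (polydisc p s) f" and A: "\<And>q. q \<in> polydisc p s \<Longrightarrow> norm (f q) \<le> A"
    and "\<delta> > 0" and q: "q \<in> polydisc p (s - \<delta>)"
  shows "norm (cpd i f q) \<le> A / \<delta>"
proof -
  let ?g = "\<lambda>t. f (q + axis i t)"
  have inP: "q + axis i t \<in> polydisc p s" if "norm t \<le> \<delta>" for t
    unfolding polydisc_def
  proof safe
    fix j
    have "dist (p $ j) ((q + axis i t) $ j) \<le> dist (p $ j) (q $ j) + norm (axis i t $ j)"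
      using dist_triangle[of "p $ j" "(q + axis i t) $ j" "q $ j"] by (simp add: dist_norm)
    moreover have "norm (axis i t $ j) \<le> \<delta>" using that \<open>\<delta> > 0\<close> by (simp add: axis_def)
    ultimately show "dist (p $ j) ((q + axis i t) $ j) < s"
      using q by (auto simp: polydisc_def dest!: spec[of _ j])
  qed
  have der: "(?g has_field_derivative cpd i f (q + axis i t)) (at t)" if "norm t \<le> \<delta>" for t
    by (rule slice_has_derivative[OF hol2_on_imp_partially_hol_on[OF f] inP[OF that]])
  have "norm ((deriv ^^ 1) ?g 0) \<le> fact 1 * A / \<delta> ^ 1"
  proof (rule Cauchy_inequality)
    show "?g holomorphic_on ball 0 \<delta>"
    proof (rule holomorphic_on_open[THEN iffD2], simp, rule ballI)
      fix t :: complex assume "t \<in> ball 0 \<delta>"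
      then show "\<exists>d. (?g has_field_derivative d) (at t)" using der[of t] by auto
    qed
    show "continuous_on (cball 0 \<delta>) ?g"
      by (rule continuous_at_imp_continuous_on) (auto intro!: DERIV_isCont der)
  qed (use A inP \<open>\<delta> > 0\<close> in auto)
  then show ?thesis by (simp add: cpd_def)
qed

text \<open>Weierstrass' theorem on each axis slice, followed by Osgood's lemma. It permits termwise
  differentiation of the Lie series for the first integral.\<close>

lemma hol2_on_uniform_limit:
  assumes U: "open U" and F: "\<And>n. hol2_on U (F n)" and lim: "uniform_limit U F g sequentially"
  shows "hol2_on U g" and "q \<in> U \<Longrightarrow> (\<lambda>n. cpd i (F n) q) \<longlonglongrightarrow> cpd i g q"
proof -
  have "continuous_on U g"
  proof (rule uniform_limit_theorem[OF _ lim])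
    show "\<forall>\<^sub>F n in sequentially. continuous_on U (F n)"
      by (rule always_eventually, rule allI, rule hol2_on_continuous_on, rule F)
  qed simp
  have *: "\<exists>d. ((\<lambda>t. g (q + axis i t)) has_field_derivative d) (at 0) \<and> (\<lambda>n. cpd i (F n) q) \<longlonglongrightarrow> d"
    if q: "q \<in> U" for q i
  proof -
    obtain e where e: "e > 0" "cball q e \<subseteq> U" using U[unfolded open_contains_cball] q by blast
    have inU: "q + axis i t \<in> U" if "t \<in> cball 0 e" for t
      using e that by (auto simp: dist_norm norm_axis subset_iff)
    have der: "((\<lambda>t. F n (q + axis i t)) has_field_derivative cpd i (F n) (q + axis i t)) (at t)" if "t \<in> cball 0 e" for t n
      by (rule slice_has_derivative[OF hol2_on_imp_partially_hol_on[OF F] inU[OF that]])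
    have "continuous_on (cball 0 e) (\<lambda>t. F n (q + axis i t))" for n
      by (rule continuous_at_imp_continuous_on) (blast intro: DERIV_isCont der)
    then have ev: "\<forall>\<^sub>F n in sequentially. continuous_on (cball 0 e) (\<lambda>t. F n (q + axis i t)) \<and>
        (\<forall>w\<in>ball 0 e. ((\<lambda>t. F n (q + axis i t)) has_field_derivative cpd i (F n) (q + axis i w)) (at w))"
      by (intro always_eventually) (simp add: der)
    have "uniform_limit (cball 0 e) (\<lambda>n t. F n (q + axis i t)) (\<lambda>t. g (q + axis i t)) sequentially"
      by (rule uniform_limit_compose'[OF lim]) (use inU in auto)
    then obtain g' where "\<And>w. w \<in> ball 0 e \<Longrightarrow> ((\<lambda>t. g (q + axis i t)) has_field_derivative (g' w)) (at w) \<and>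
        ((\<lambda>n. cpd i (F n) (q + axis i w)) \<longlonglongrightarrow> g' w)"
      by (rule has_complex_derivative_uniform_limit[OF ev _ _ e(1)], simp) (rule that)
    from this[of 0] e(1) show ?thesis by (auto simp: axis_zero)
  qed
  then have "partially_hol_on U g"
    using \<open>continuous_on U g\<close> unfolding partially_hol_on_def field_differentiable_def by blast
  then show "hol2_on U g" by (rule partially_hol_on_imp_hol2_on[OF U])
  show "(\<lambda>n. cpd i (F n) q) \<longlonglongrightarrow> cpd i g q" if "q \<in> U"
  proof -
    obtain d where "((\<lambda>t. g (q + axis i t)) has_field_derivative d) (at 0)" "(\<lambda>n. cpd i (F n) q) \<longlonglongrightarrow> d"
      using *[OF \<open>q \<in> U\<close>] by blast
    then show ?thesis unfolding cpd_def[of i g] by (simp add: DERIV_imp_deriv)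
  qed
qed

lemma bounded_linear_matrix_mult: "bounded_linear (\<lambda>h. A *v (h::complex^2))" for A :: "complex^2^2"
proof (intro linear_conv_bounded_linear[THEN iffD1] linearI)
  show "A *v (h + k) = A *v h + A *v k" for h k
    by (rule matrix_vector_right_distrib)
  show "A *v (r *\<^sub>R h) = r *\<^sub>R (A *v h)" for r h
    by (simp add: vec_eq_iff matrix_vector_mult_def scaleR_right.sum)
qed

text \<open>The real inverse function theorem produces G. Its derivative inverts the complex-linear
  map \<open>cjac F\<close>, so it is complex-linear as well, and G is holomorphic.\<close>

lemma hol2_inverse_function:
  assumes U: "open U" and F: "hol2_map_on U F" and p: "p \<in> U" and inv: "invertible (cjac F p)"
  obtains V W G where "open V" "V \<subseteq> U" "p \<in> V" "open W" "homeomorphism V W F G" "hol2_map_on W G"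
    "\<And>q h. q \<in> W \<Longrightarrow> cjac G q *v (cjac F (G q) *v h) = h"
proof -
  define D where "D q = Blinfun (\<lambda>h. cjac F q *v h)" for q
  have D: "blinfun_apply (D q) h = cjac F q *v h" for q h
    by (simp add: D_def bounded_linear_Blinfun_apply[OF bounded_linear_matrix_mult])
  have derF: "(F has_derivative blinfun_apply (D q)) (at q)" if "q \<in> U" for q
  proof -
    have "blinfun_apply (D q) = (\<lambda>h. cjac F q *v h)" by (simp add: D fun_eq_iff)
    then show ?thesis using hol2_map_on_has_derivative[OF F that] by (simp only:)
  qed
  have contD: "continuous_on U D"
  proof (rule continuous_on_blinfun_componentwise)
    fix b :: "complex^2"
    have "continuous_on U (\<lambda>q. axis 1 (dird (\<lambda>q. F q $ 1) q b) + axis 2 (dird (\<lambda>q. F q $ 2) q b) :: complex^2)"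
      using F by (intro continuous_intros hol2_on_continuous_on[OF hol2_on_dird[OF U]])
        (auto simp: hol2_map_on_def hol2_on_const)
    then show "continuous_on U (\<lambda>q. blinfun_apply (D q) b)"
      by (simp add: D cjac_mult_nth[symmetric])
  qed
  obtain B where B: "B ** cjac F p = mat 1" using inv unfolding invertible_def by blast
  have inv: "Blinfun (\<lambda>h. B *v h) o\<^sub>L D p = id_blinfun"
    by (rule blinfun_eqI) (simp add: D bounded_linear_Blinfun_apply[OF bounded_linear_matrix_mult] matrix_vector_mul_assoc B)
  obtain V W G G' where *: "open V" "V \<subseteq> U" "p \<in> V" "open W" "homeomorphism V W F G"
    and G: "\<And>y. y \<in> W \<Longrightarrow> (G has_derivative (G' y)) (at y)"
    and G': "\<And>y. y \<in> W \<Longrightarrow> G' y = Hilbert_Choice.inv (blinfun_apply (D (G y)))"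
    and bij: "\<And>y. y \<in> W \<Longrightarrow> bij (blinfun_apply (D (G y)))"
    by (rule inverse_function_theorem[OF U derF contD p inv], assumption) (rule that)
  have GF: "G' q (cjac F (G q) *v h) = h" if "q \<in> W" for q h
    using bij[OF that] unfolding G'[OF that] D[symmetric] by (simp add: bij_is_inj)
  \<comment> \<open>By surjectivity h is an image under \<open>cjac F\<close>; scaling the preimage
    and applying the left inverse transfers homogeneity from \<open>cjac F\<close> to its
    inverse.\<close>
  have lin: "G' q (c *s h) = c *s G' q h" if q: "q \<in> W" for q c h
  proof -
    obtain k where "h = cjac F (G q) *v k"
      using bij_is_surj[OF bij[OF q]] unfolding surj_def D by metis
    then show ?thesis using GF[OF q] by (simp add: matrix_vector_mult_scale[symmetric])
  qed
  have der: "((\<lambda>q. G q $ i) has_derivative (\<lambda>h. G' q h $ i)) (at q)" if "q \<in> W" for i q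
    by (rule bounded_linear.has_derivative[OF bounded_linear_vec_nth G[OF that]])
  have hG: "hol2_map_on W G"
    unfolding hol2_map_on_def
    by (intro allI hol2_on_has_derivative_imp(1)[OF der]) (simp_all add: lin)
  have "cjac G q *v h = G' q h" if "q \<in> W" for q h
    using has_derivative_unique[OF hol2_map_on_has_derivative[OF hG that] G[OF that]] by metis
  then show ?thesis using that[OF * hG] GF by simp
qed

section \<open>First integrals\<close>

definition lieD :: "vfield \<Rightarrow> (complex^2 \<Rightarrow> complex) \<Rightarrow> complex^2 \<Rightarrow> complex" where
  "lieD X g = (\<lambda>q. dird g q (X q))"

lemma hol2_on_lieD_funpow:
  assumes "open U" "hol2_map_on U X" "hol2_on U g"
  shows "hol2_on U ((lieD X ^^ n) g)"
  using assms by (induction n) (auto simp: lieD_def intro: hol2_on_dird)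

text \<open>Cauchy's inequality bounds each of the two partial derivatives by A / \<delta>; the
  factor 2 counts the coordinates.\<close>

lemma norm_lieD_le:
  assumes g: "hol2_on (polydisc p s) g" "\<And>q. q \<in> polydisc p s \<Longrightarrow> norm (g q) \<le> A"
    and X: "\<And>q i. q \<in> polydisc p s \<Longrightarrow> norm (X q $ i) \<le> M"
    and \<delta>: "\<delta> > 0" and q: "q \<in> polydisc p (s - \<delta>)"
  shows "norm (lieD X g q) \<le> A * (2 * M / \<delta>)"
proof -
  have q': "q \<in> polydisc p s" using q \<delta> polydisc_mono[of "s - \<delta>" s p] by auto
  have "norm (lieD X g q) \<le> norm (cpd 1 g q * X q $ 1) + norm (cpd 2 g q * X q $ 2)"
    unfolding lieD_def dird_def by (rule norm_triangle_ineq)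
  also have "\<dots> \<le> A / \<delta> * M + A / \<delta> * M"
    unfolding norm_mult using cpd_Cauchy_inequality[OF g \<delta> q] X[OF q']
    by (intro add_mono mult_mono) (auto intro: order_trans[OF norm_ge_zero])
  finally show ?thesis by (simp add: field_simps)
qed

lemma norm_lieD_funpow_le:
  assumes g: "hol2_on (polydisc p r) g" "\<And>q. q \<in> polydisc p r \<Longrightarrow> norm (g q) \<le> A"
    and X: "hol2_map_on (polydisc p r) X" "\<And>q i. q \<in> polydisc p r \<Longrightarrow> norm (X q $ i) \<le> M"
    and \<delta>: "\<delta> > 0"
  shows "q \<in> polydisc p (r - real n * \<delta>) \<Longrightarrow> norm ((lieD X ^^ n) g q) \<le> A * (2 * M / \<delta>) ^ n"
proof (induction n arbitrary: q)
  case (Suc n)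
  have sub: "polydisc p (r - real n * \<delta>) \<subseteq> polydisc p r" using \<delta> by (intro polydisc_mono) simp
  have "norm (lieD X ((lieD X ^^ n) g) q) \<le> A * (2 * M / \<delta>) ^ n * (2 * M / \<delta>)"
  proof (rule norm_lieD_le[OF _ _ _ \<delta>])
    show "hol2_on (polydisc p (r - real n * \<delta>)) ((lieD X ^^ n) g)"
      by (rule hol2_on_subset[OF hol2_on_lieD_funpow[OF open_polydisc X(1) g(1)] sub])
    show "q \<in> polydisc p (r - real n * \<delta> - \<delta>)"
      using Suc.prems by (simp add: algebra_simps)
  qed (use sub X(2) Suc.IH in auto)
  then show ?case by (simp add: mult_ac)
qed (use g in simp)

text \<open>n^n / n! is a single term of the exponential series at n.\<close>

lemma power_le_exp_fact: "real n ^ n \<le> exp (real n) * fact n"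
proof -
  have "(\<Sum>k\<in>{n}. real n ^ k /\<^sub>R fact k) \<le> (\<Sum>k. real n ^ k /\<^sub>R fact k)"
    by (rule sum_le_suminf[OF summable_exp_generic]) auto
  then show ?thesis by (simp add: exp_def field_simps)
qed

text \<open>The loss per derivative is taken as r / (2 n), so that n derivatives together use up
  r/2. The resulting n^n is at most e^n n!. Growth of order n! is exactly what the coefficients 1/n!
  of a Lie series can compensate, leaving a geometric series.\<close>

lemma norm_lieD_funpow_le_fact:
  assumes g: "hol2_on (polydisc p r) g" "\<And>q. q \<in> polydisc p r \<Longrightarrow> norm (g q) \<le> A"
    and X: "hol2_map_on (polydisc p r) X" "\<And>q i. q \<in> polydisc p r \<Longrightarrow> norm (X q $ i) \<le> M"
    and r: "r > 0" and q: "q \<in> polydisc p (r/2)"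
  shows "norm ((lieD X ^^ n) g q) \<le> A * (4 * M * exp 1 / r) ^ n * fact n"
proof (cases "n = 0")
  case True
  then show ?thesis using g(2) q polydisc_mono[of "r/2" r p] r by auto
next
  case False
  have pr: "p \<in> polydisc p r" using r by (rule centre_in_polydisc)
  have A: "0 \<le> A" and M: "0 \<le> M"
    using g(2)[OF pr] X(2)[OF pr] by (meson norm_ge_zero order_trans)+
  define \<delta> where "\<delta> = r / (2 * real n)"
  have \<delta>: "\<delta> > 0" "r - real n * \<delta> = r/2" using False r by (auto simp: \<delta>_def)
  have "norm ((lieD X ^^ n) g q) \<le> A * (2 * M / \<delta>) ^ n"
    by (rule norm_lieD_funpow_le[OF g X \<delta>(1)]) (use q in \<open>simp_all only: \<delta>(2)\<close>)
  also have "(2 * M / \<delta>) ^ n = (4 * M / r) ^ n * real n ^ n"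
    by (simp add: \<delta>_def power_mult_distrib[symmetric] mult.assoc)
  also have "A * ((4 * M / r) ^ n * real n ^ n) \<le> A * ((4 * M / r) ^ n * (exp (real n) * fact n))"
    using A M r by (intro mult_left_mono power_le_exp_fact) auto
  also have "\<dots> = A * (4 * M * exp 1 / r) ^ n * fact n"
    using exp_of_nat_mult[of n "1::real"] by (simp add: power_mult_distrib power_divide)
  finally show ?thesis .
qed

text \<open>
  The first integral is the Lie series \<open>exp (- f X) z = \<Sum>\<^sub>n (- f)\<^sup>n / n! X\<^sup>n z\<close>: as \<open>X f = 1\<close>, applying \<open>X\<close> to it
  gives a telescoping sum.
\<close>

lemma first_integral_exists:
  assumes U: "open U" "p \<in> U" and X: "hol2_map_on U X" and f: "hol2_on U f"
    and Xf: "\<And>q. q \<in> U \<Longrightarrow> dird f q (X q) = 1" and fp: "f p = 0"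
  obtains V v where "open V" "p \<in> V" "V \<subseteq> U" "hol2_on V v" "\<And>q. q \<in> V \<Longrightarrow> dird v q (X q) = 0"
    "invertible (cjac (\<lambda>q. vector [f q, v q]) p)"
proof -
  \<comment> \<open>X f = 1 prevents df from vanishing at p. Choosing i with a nonzero partial
    derivative leaves the other coordinate z = q $ j with dz independent of df at p; the series
    starts from this z.\<close>
  obtain i j :: 2 where ij: "cpd i f p \<noteq> 0" "\<And>h. dird f p h = cpd i f p * h $ i + cpd j f p * h $ j"
    "\<And>h::complex^2. h = 0 \<longleftrightarrow> h $ i = 0 \<and> h $ j = 0"
  proof (cases "cpd 1 f p = 0")
    case True
    then have "cpd 2 f p \<noteq> 0" using Xf[OF U(2)] by (auto simp: dird_def)
    then show ?thesis by (intro that[of 2 1]) (auto simp: dird_def vec_eq_iff forall_2)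
  next
    case False
    then show ?thesis by (intro that[of 1 2]) (auto simp: dird_def vec_eq_iff forall_2)
  qed
  define z :: "complex^2 \<Rightarrow> complex" where "z = (\<lambda>q. q $ j)"
  obtain r0 where r0: "r0 > 0" "polydisc p r0 \<subseteq> U" using polydisc_exhausts[OF U] by blast
  define r where "r = r0 / 2"
  \<comment> \<open>This closed polydisc is compact, which supplies the uniform bounds M for X and A
    for z.\<close>
  define Q where "Q = {q. \<forall>i. dist (p $ i) (q $ i) \<le> r}"
  have "Q \<subseteq> polydisc p r0"
  proof
    fix q assume "q \<in> Q"
    then have "dist (p $ i) (q $ i) \<le> r" for i by (simp add: Q_def)
    moreover have "r < r0" using r0 by (simp add: r_def)
    ultimately show "q \<in> polydisc p r0" unfolding polydisc_def by (blast intro: le_less_trans)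
  qed
  then have r: "r > 0" "Q \<subseteq> U" "polydisc p r \<subseteq> Q"
    using r0 by (auto simp: r_def Q_def polydisc_def less_imp_le)
  have "bounded (X ` Q)" "bounded ((\<lambda>q. q) ` Q)"
    using hol2_map_on_continuous_on[OF X] r(2) compact_closed_polydisc[of p r]
    by (auto intro!: compact_imp_bounded compact_continuous_image intro: continuous_on_subset simp: Q_def[symmetric] simp del: image_ident)
  then obtain M A where "M > 0" and M: "\<And>q. q \<in> Q \<Longrightarrow> norm (X q) \<le> M" and A: "\<And>q. q \<in> Q \<Longrightarrow> norm q \<le> A"
    unfolding bounded_pos by auto
  have Xi: "norm (X q $ i) \<le> M" if "q \<in> polydisc p r" for q i
    by (rule order_trans[OF Finite_Cartesian_Product.norm_nth_le M]) (use that r(3) in blast)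
  have zA: "norm (z q) \<le> A" if "q \<in> polydisc p r" for q
    unfolding z_def by (rule order_trans[OF Finite_Cartesian_Product.norm_nth_le A]) (use that r(3) in blast)
  define K where "K = 4 * M * exp 1 / r"
  have K: "K > 0" using \<open>M > 0\<close> r by (simp add: K_def)
  \<comment> \<open>The half polydisc is where the factorial estimate holds. The condition on f
    gives |f| K < 1/2, so the n-th term of the series is at most A / 2^n; it holds near p because f
    p = 0.\<close>
  define V where "V = polydisc p (r/2) \<inter> {q \<in> U. norm (f q) < 1 / (2*K)}"
  have "{q \<in> U. norm (f q) < 1 / (2*K)} = U \<inter> f -` ball 0 (1 / (2*K))" by auto
  then have "open {q \<in> U. norm (f q) < 1 / (2*K)}"
    using continuous_open_preimage[OF hol2_on_continuous_on[OF f] U(1) open_ball] by simp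
  then have V: "open V" "p \<in> V" "V \<subseteq> U"
    using r(1) K fp U centre_in_polydisc[of "r/2" p] by (auto simp: V_def open_polydisc)
  define D where "D n = (lieD X ^^ n) z" for n
  have D_Suc: "D (Suc n) q = dird (D n) q (X q)" for n q by (simp add: D_def lieD_def)
  have hD: "hol2_on V (D n)" for n
    unfolding D_def z_def
    by (rule hol2_on_lieD_funpow[OF V(1) hol2_map_on_subset[OF X V(3)] hol2_on_coord])
  have D_le: "norm (D n q) \<le> A * K ^ n * fact n" if "q \<in> V" for n q
    unfolding D_def K_def
    by (rule norm_lieD_funpow_le_fact[OF _ zA _ Xi r(1)])
      (use that r X in \<open>auto simp: V_def z_def hol2_on_coord intro: hol2_map_on_subset\<close>)
  have fV: "hol2_on V f" by (rule hol2_on_subset[OF f V(3)])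
  have fK: "norm (f q) ^ n * K ^ n \<le> (1/2) ^ n" if "q \<in> V" for n q
  proof -
    have "norm (f q) * K \<le> 1/2" using that K by (simp add: V_def field_simps)
    then show ?thesis using K by (metis power_mono power_mult_distrib mult_nonneg_nonneg norm_ge_zero less_imp_le)
  qed
  have "A \<ge> 0" by (rule order_trans[OF norm_ge_zero zA[OF centre_in_polydisc[OF r(1)]]])
  define T where "T n q = (-1) ^ n / fact n * (f q ^ n * D n q)" for n q
  have hT: "hol2_on V (T n)" for n
    unfolding T_def by (intro hol2_on_mult hol2_on_const hol2_on_power fV hD)
  have dT: "dird (T n) q h = (-1) ^ n / fact n * (f q ^ n * dird (D n) q h + of_nat n * f q ^ (n - 1) * dird f q h * D n q)"
    if "q \<in> V" for n q h
    unfolding T_def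
    by (simp only: dird_mult_fun[OF hol2_on_const hol2_on_mult[OF hol2_on_power[OF fV] hD] that]
      dird_mult_fun[OF hol2_on_power[OF fV] hD that] dird_power[OF fV that] dird_const mult_zero_left add_0_right)
  have T_le: "norm (T n q) \<le> A * (1/2) ^ n" if "q \<in> V" for n q
  proof -
    have "norm (T n q) = norm (f q) ^ n / fact n * norm (D n q)"
      by (simp add: T_def norm_mult norm_divide norm_power)
    also have "\<dots> \<le> norm (f q) ^ n / fact n * (A * K ^ n * fact n)"
      by (intro mult_left_mono D_le that) simp
    also have "\<dots> = A * (norm (f q) ^ n * K ^ n)" by simp
    also have "\<dots> \<le> A * (1/2) ^ n" by (intro mult_left_mono fK that \<open>A \<ge> 0\<close>)
    finally show ?thesis .
  qed
  define v where "v q = (\<Sum>n. T n q)" for q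
  define S where "S n q = (\<Sum>i<n. T i q)" for n q
  have "uniform_limit V S v sequentially"
    unfolding S_def v_def using T_le by (rule Weierstrass_m_test) (auto intro!: summable_mult summable_geometric)
  moreover have hS: "hol2_on V (S n)" for n
    unfolding S_def by (intro hol2_on_sum hT)
  ultimately have hv: "hol2_on V v" and "\<And>q i. q \<in> V \<Longrightarrow> (\<lambda>n. cpd i (S n) q) \<longlonglongrightarrow> cpd i v q"
    using hol2_on_uniform_limit[OF V(1)] by blast+
  then have lim: "(\<lambda>n. dird (S n) q h) \<longlonglongrightarrow> dird v q h" if "q \<in> V" for q h
    unfolding dird_def using that by (intro tendsto_intros) auto
  have dS: "dird (S n) q h = (\<Sum>i<n. dird (T i) q h)" if "q \<in> V" for n q h
    unfolding S_def using dird_sum[of "{..<n}" V T, OF hT that] by simp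
  have "dird v q (X q) = 0" if q: "q \<in> V" for q
  proof -
    have Xf1: "dird f q (X q) = 1" using Xf q V(3) by auto
    \<comment> \<open>With X f = 1, differentiating f^(n+1) in term n+1 cancels what term n left
      over. Only the part of the last term containing the next iterate \<open>D (Suc n)\<close>
      survives.\<close>
    have tele: "dird (S (Suc n)) q (X q) = (-1) ^ n / fact n * (f q ^ n * D (Suc n) q)" for n
    proof (induction n)
      case 0
      then show ?case by (simp add: dS[OF q] dT[OF q] D_Suc)
    next
      case (Suc n)
      have "dird (S (Suc (Suc n))) q (X q) = dird (S (Suc n)) q (X q) + dird (T (Suc n)) q (X q)"
        by (simp add: dS[OF q])
      also have "\<dots> = (-1) ^ Suc n / fact (Suc n) * (f q ^ Suc n * D (Suc (Suc n)) q)"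
        unfolding Suc dT[OF q] Xf1 D_Suc[of "Suc n"] by (simp add: field_simps del: of_nat_Suc)
      finally show ?case .
    qed
    \<comment> \<open>The surviving part has n! in the denominator but an iterate bounded by (n+1)!,
      so a factor n+1 appears; the geometric factor still drives it to 0.\<close>
    have le: "norm (dird (S (Suc n)) q (X q)) \<le> A * K * 2 * (real (Suc n) / 2 ^ Suc n)" for n
    proof -
      have "norm (dird (S (Suc n)) q (X q)) = norm (f q) ^ n / fact n * norm (D (Suc n) q)"
        by (simp add: tele norm_mult norm_divide norm_power)
      also have "\<dots> \<le> norm (f q) ^ n / fact n * (A * K ^ Suc n * fact (Suc n))"
        by (intro mult_left_mono D_le q) simp
      also have "\<dots> = A * K * real (Suc n) * (norm (f q) ^ n * K ^ n)" by (simp add: field_simps)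
      also have "\<dots> \<le> A * K * real (Suc n) * (1/2) ^ n"
        using \<open>A \<ge> 0\<close> K by (intro mult_left_mono fK q) simp
      finally show ?thesis by (simp add: power_divide)
    qed
    have "(\<lambda>n. A * K * 2 * (real (Suc n) / 2 ^ Suc n)) \<longlonglongrightarrow> A * K * 2 * 0"
      by (intro tendsto_mult tendsto_const LIMSEQ_Suc lim_n_over_pown) simp
    then have "(\<lambda>n. A * K * 2 * (real (Suc n) / 2 ^ Suc n)) \<longlonglongrightarrow> 0"
      by (simp only: mult_zero_right)
    then have "(\<lambda>n. dird (S (Suc n)) q (X q)) \<longlonglongrightarrow> 0"
      by (rule Lim_null_comparison[OF always_eventually[OF allI[OF le]]])
    then show ?thesis using LIMSEQ_Suc[OF lim[OF q]] LIMSEQ_unique by blast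
  qed
  moreover have "invertible (cjac (\<lambda>q. vector [f q, v q]) p)"
  proof -
    \<comment> \<open>Since f p = 0, terms of index at least 2 have zero derivative at p. Terms 0
      and 1 give dv = dz - (X z) df, so dv agrees with dz modulo df and is independent of
      df.\<close>
    have dv: "dird v p h = h $ j - dird f p h * D 1 p" for h
    proof -
      have T0: "dird (T i) p h = 0" if "i \<ge> 2" for i
        using that by (simp add: dT[OF V(2)] fp power_0_left)
      have "(\<Sum>i<n + 2. dird (T i) p h) = dird (T 0) p h + dird (T 1) p h" for n
        by (induction n) (simp_all add: T0 numeral_2_eq_2)
      then have "dird (S (n + 2)) p h = h $ j - dird f p h * D 1 p" for n
        by (simp add: dS[OF V(2)] dT[OF V(2)] fp D_def z_def dird_coord)
      then show ?thesis
        using LIMSEQ_ignore_initial_segment[OF lim[OF V(2), of h], of 2] by (simp add: LIMSEQ_const_iff)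
    qed
    have "h = 0" if "cjac (\<lambda>q. vector [f q, v q]) p *v h = 0" for h
    proof -
      have "(cjac (\<lambda>q. vector [f q, v q]) p *v h) $ 1 = dird f p h"
        "(cjac (\<lambda>q. vector [f q, v q]) p *v h) $ 2 = dird v p h"
        unfolding cjac_mult_nth by simp_all
      then have "dird f p h = 0" "h $ j = 0" using that dv[of h] by auto
      then show ?thesis using ij by simp
    qed
    then show ?thesis by (simp add: invertible_left_inverse matrix_left_invertible_ker)
  qed
  ultimately show ?thesis by (rule that[OF V hv])
qed

section \<open>Fields affine in \<open>x\<close>\<close>

lemma hol2_on_compose_holomorphic:
  assumes g: "g holomorphic_on D" "open D" and f: "hol2_on U f" "f ` U \<subseteq> D"
  shows "hol2_on U (\<lambda>q. g (f q))"
    and dird_compose_holomorphic: "p \<in> U \<Longrightarrow> dird (\<lambda>q. g (f q)) p h = deriv g (f p) * dird f p h"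
proof -
  have der: "((\<lambda>q. g (f q)) has_derivative (\<lambda>h. deriv g (f p) * dird f p h)) (at p)" if p: "p \<in> U" for p
  proof -
    have "(g has_derivative (*) (deriv g (f p))) (at (f p))"
      using holomorphic_derivI[OF g, of "f p"] f(2) p by (auto simp: has_field_derivative_def)
    then show ?thesis by (rule has_derivative_compose[OF hol2_onD[OF f(1) p]])
  qed
  note * = hol2_on_has_derivative_imp[OF der, of U]
  show "hol2_on U (\<lambda>q. g (f q))" by (rule *) (simp_all add: dird_scale)
  show "p \<in> U \<Longrightarrow> dird (\<lambda>q. g (f q)) p h = deriv g (f p) * dird f p h"
    by (rule *) (simp_all add: dird_scale)
qed

lemma lie_bracket_zero_at: "X p = 0 \<Longrightarrow> Y p = 0 \<Longrightarrow> lie_bracket X Y p = 0"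
  by (simp add: lie_bracket_def)

text \<open>By the product rule the terms differentiating X cancel, so brackets of multiples of one
  field reduce to scalar identities for the multipliers. This is the main computational tool in rank
  one.\<close>

lemma lie_bracket_multiples:
  assumes B: "open B" and X: "hol2_map_on B X" and f: "hol2_on B f" and g: "hol2_on B g"
    and Y: "\<And>q. q \<in> B \<Longrightarrow> Y q = f q *s X q" and Z: "\<And>q. q \<in> B \<Longrightarrow> Z q = g q *s X q" and q: "q \<in> B"
  shows "lie_bracket Y Z q = (f q * dird g q (X q) - g q * dird f q (X q)) *s X q"
proof -
  have Xi: "hol2_on B (\<lambda>q. X q $ i)" for i using X by (simp add: hol2_map_on_def)
  have "dird (\<lambda>q. Y q $ i) q h = f q * dird (\<lambda>q. X q $ i) q h + dird f q h * X q $ i" for i h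
    using dird_cong[OF B hol2_on_mult[OF f Xi] _ q, of i "\<lambda>q. Y q $ i"] Y dird_mult_fun[OF f Xi q] by simp
  moreover have "dird (\<lambda>q. Z q $ i) q h = g q * dird (\<lambda>q. X q $ i) q h + dird g q h * X q $ i" for i h
    using dird_cong[OF B hol2_on_mult[OF g Xi] _ q, of i "\<lambda>q. Z q $ i"] Z dird_mult_fun[OF g Xi q] by simp
  ultimately show ?thesis
    by (simp add: vec_eq_iff lie_bracket_nth Y[OF q] Z[OF q] dird_scale algebra_simps)
qed

lemma vf_of_nth: "vf_of U P Q q $ 1 = (if q \<in> U then P q else 0)" "vf_of U P Q q $ 2 = (if q \<in> U then Q q else 0)"
  by (simp_all add: vf_of_def)

lemma vf_eq_iff: "X = Y \<longleftrightarrow> (\<forall>q. X q $ 1 = Y q $ 1 \<and> X q $ 2 = (Y q :: complex^2) $ 2)"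
  by (auto simp: fun_eq_iff vec_eq_iff forall_2)

lemma vf_scale_nth: "vf_scale c X q $ i = c * X q $ i"
  by (simp add: vf_scale_def)

lemma vf_nth: "(X + Y) q $ i = X q $ i + Y q $ i" "(X - Y) q $ i = X q $ i - Y q $ i" "(0::vfield) q $ i = 0"
  for X Y :: vfield
  by simp_all

lemma snd_image_polydisc:
  assumes "r > 0"
  shows "(\<lambda>q. q $ 2) ` polydisc w r = ball (w $ 2) r"
proof
  show "ball (w $ 2) r \<subseteq> (\<lambda>q. q $ 2) ` polydisc w r"
  proof
    fix y assume "y \<in> ball (w $ 2) r"
    then have "vector [w $ 1, y] \<in> polydisc w r" using assms by (simp add: polydisc_def forall_2)
    then show "y \<in> (\<lambda>q. q $ 2) ` polydisc w r" by (force simp: image_iff)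
  qed
qed (auto simp: polydisc_def)

definition affine_field :: "(complex^2) set \<Rightarrow> complex \<Rightarrow> (complex \<Rightarrow> complex) \<Rightarrow> vfield" where
  "affine_field W c \<eta> = vf_of W (\<lambda>q. c * q $ 1 + \<eta> (q $ 2)) (\<lambda>q. 0)"

lemma affine_field_lincomb:
  "vf_scale a (affine_field W c \<eta>) + vf_scale b (affine_field W d \<psi>) =
    affine_field W (a * c + b * d) (\<lambda>y. a * \<eta> y + b * \<psi> y)"
  by (auto simp: vf_eq_iff vf_scale_nth vf_of_nth affine_field_def algebra_simps)

text \<open>Both fields are multiples of the constant field \<open>?e\<close>, that is
  \<open>\<partial>\<^sub>x\<close>, with multipliers whose x-derivatives are c and d; the terms c d
  x cancel.\<close>

lemma lie_bracket_affine_field: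
  assumes W: "W = polydisc w r" and \<eta>: "\<eta> holomorphic_on ball (w $ 2) r" and \<psi>: "\<psi> holomorphic_on ball (w $ 2) r"
  shows "lie_bracket (affine_field W c \<eta>) (affine_field W d \<psi>) = affine_field W 0 (\<lambda>y. d * \<eta> y - c * \<psi> y)"
proof
  fix q
  let ?e = "vector [1, 0] :: complex^2"
  define f where "f c \<eta> q = c * q $ 1 + \<eta> (q $ 2)" for c \<eta> and q :: "complex^2"
  have sub: "(\<lambda>q. q $ 2) ` W \<subseteq> ball (w $ 2) r" by (auto simp: W polydisc_def)
  show "lie_bracket (affine_field W c \<eta>) (affine_field W d \<psi>) q = affine_field W 0 (\<lambda>y. d * \<eta> y - c * \<psi> y) q"
  proof (cases "q \<in> W")
    case True
    have hf: "hol2_on W (f c \<eta>)" and df: "dird (f c \<eta>) q ?e = c"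
      if "\<eta> holomorphic_on ball (w $ 2) r" for c \<eta>
    proof -
      note 1 = hol2_on_mult[OF hol2_on_const hol2_on_coord[of W 1], of c]
      note 2 = hol2_on_compose_holomorphic(1)[OF that open_ball hol2_on_coord sub]
      show "hol2_on W (f c \<eta>)" unfolding f_def by (rule hol2_on_add[OF 1 2])
      show "dird (f c \<eta>) q ?e = c"
        unfolding f_def dird_add_fun[OF 1 2 True]
        by (simp add: dird_mult_fun[OF hol2_on_const hol2_on_coord True] dird_const dird_coord
            dird_compose_holomorphic[OF that open_ball hol2_on_coord sub True])
    qed
    have "hol2_map_on W (\<lambda>_. ?e)" by (simp add: hol2_map_on_def hol2_on_const)
    from lie_bracket_multiples[OF _ this hf[OF \<eta>, of c] hf[OF \<psi>, of d] _ _ True,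
        of "affine_field W c \<eta>" "affine_field W d \<psi>"]
    have "lie_bracket (affine_field W c \<eta>) (affine_field W d \<psi>) q = (f c \<eta> q * d - f d \<psi> q * c) *s ?e"
      unfolding df[OF \<eta>] df[OF \<psi>]
      by (auto simp: W open_polydisc affine_field_def vf_of_def f_def vec_eq_iff forall_2)
    then show ?thesis using True
      by (simp add: affine_field_def vf_of_def f_def vec_eq_iff forall_2 algebra_simps)
  next
    case False
    then show ?thesis by (simp add: lie_bracket_zero_at affine_field_def vf_of_def)
  qed
qed

lemma C_inf1_on_holomorphic: "open D \<Longrightarrow> \<eta> holomorphic_on D \<Longrightarrow> C_inf1_on D \<eta>"
  unfolding C_inf1_on_def using holomorphic_higher_deriv by blast

text \<open>A basis of K is finite because K lies in the finite-dimensional H. A linear relation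
  between the functions on D is a relation between the fields, since D consists precisely of the
  y-values on W and the fields vanish outside W.\<close>

lemma span_vertical_fields:
  assumes K: "vf.subspace K" "vf_finite_dim H" "K \<subseteq> H"
    and KD: "\<And>T. T \<in> K \<Longrightarrow> \<exists>\<eta>. \<eta> holomorphic_on D \<and> T = affine_field W 0 \<eta>"
    and D: "D = (\<lambda>q. q $ 2) ` W"
  shows "\<exists>N \<phi>. K = vf.span {affine_field W 0 (\<phi> i) | i. i \<in> {1..N}} \<and>
    (\<forall>i\<in>{1..N}. \<phi> i holomorphic_on D) \<and> lin_indep_on D N \<phi>"
proof -
  obtain S where S: "S \<subseteq> K" "vf.independent S" "K \<subseteq> vf.span S"
    using vf.maximal_independent_subset by blast
  have "finite S"
    using K(2,3) S(1,2) vf.independent_span_bound unfolding vf_finite_dim_def by blast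
  then obtain b where b: "bij_betw b {1..card S} S"
    using ex_bij_betw_nat_finite_1 by blast
  define N where "N = card S"
  have "\<exists>\<eta>. \<eta> holomorphic_on D \<and> b i = affine_field W 0 \<eta>" if "i \<in> {1..N}" for i
    by (intro KD subsetD[OF S(1)] bij_betw_apply[OF b]) (use that in \<open>simp add: N_def\<close>)
  then obtain \<phi> where \<phi>: "\<And>i. i \<in> {1..N} \<Longrightarrow> \<phi> i holomorphic_on D" "\<And>i. i \<in> {1..N} \<Longrightarrow> b i = affine_field W 0 (\<phi> i)"
    by metis
  have "S = b ` {1..N}" using b by (simp add: bij_betw_def N_def)
  then have "S = {affine_field W 0 (\<phi> i) | i. i \<in> {1..N}}"
    using \<phi>(2) by (auto simp: image_iff)
  moreover have "K = vf.span S"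
    using S(1,3) vf.span_minimal[OF _ K(1)] by blast
  moreover have "lin_indep_on D N \<phi>"
    unfolding lin_indep_on_def
  proof (intro allI impI ballI)
    fix c i assume c: "\<forall>y\<in>D. (\<Sum>i = 1..N. c i * \<phi> i y) = 0" and i: "i \<in> {1..N}"
    \<comment> \<open>The coefficients are moved from indices to basis vectors through the
      enumeration b, the form in which independence of S applies.\<close>
    define u where "u T = c (inv_into {1..N} b T)" for T
    have ub: "u (b i) = c i" if "i \<in> {1..N}" for i
      using b that by (simp add: u_def N_def bij_betw_def)
    have "(\<Sum>T\<in>S. vf_scale (u T) T) = (\<Sum>i\<in>{1..N}. vf_scale (u (b i)) (b i))"
      using sum.reindex_bij_betw[OF b, of "\<lambda>T. vf_scale (u T) T"] by (simp add: N_def)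
    also have "\<dots> = (\<Sum>i\<in>{1..N}. vf_scale (c i) (affine_field W 0 (\<phi> i)))"
      by (intro sum.cong) (simp_all add: ub \<phi>(2)[symmetric])
    also have "\<dots> = 0"
    proof -
      have nth: "(\<Sum>i\<in>I. F i) q $ k = (\<Sum>i\<in>I. F i q $ k)" for F :: "nat \<Rightarrow> vfield" and I q k
        by (induction I rule: infinite_finite_induct) auto
      have "(\<Sum>i\<in>{1..N}. c i * (if q \<in> W then \<phi> i (q $ 2) else 0)) = 0" for q
        using c D by (cases "q \<in> W") auto
      then show ?thesis
        by (simp add: vf_eq_iff nth vf_scale_nth affine_field_def vf_of_nth)
    qed
    finally have "u (b i) = 0"
      using vf.independentD[OF S(2) \<open>finite S\<close> order_refl] b i by (auto simp: N_def dest: bij_betwE)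
    then show "c i = 0" using ub[OF i] by simp
  qed
  ultimately show ?thesis using \<phi>(1) by blast
qed

text \<open>The subspace K of fields without an x-term is the derived algebra: a bracket of affine
  fields never has an x-term, and conversely T = [T, \<open>?E\<close>] for T in K. Subtracting c
  times \<open>?E\<close> from a field with x-coefficient c lands in K, which gives the sum
  decomposition.\<close>

lemma rank_one_formI:
  assumes W: "W = polydisc w r" "r > 0" and h: "vf.subspace \<hh>" "vf_finite_dim \<hh>"
    and form: "\<And>T. T \<in> \<hh> \<Longrightarrow> \<exists>c \<eta>. \<eta> holomorphic_on ball (w $ 2) r \<and> T = affine_field W c \<eta>"
    and E: "affine_field W 1 (\<lambda>_. 0) \<in> \<hh>"
  shows "rank_one_form W \<hh>"
proof -
  let ?D = "ball (w $ 2) r" and ?E = "affine_field W 1 (\<lambda>_. 0)"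
  define K where "K = {T \<in> \<hh>. \<exists>\<eta>. \<eta> holomorphic_on ?D \<and> T = affine_field W 0 \<eta>}"
  have KI: "T \<in> K" if "T \<in> \<hh>" "T = affine_field W 0 \<eta>" "\<eta> holomorphic_on ?D" for T \<eta>
    using that by (auto simp: K_def)
  have K: "vf.subspace K"
  proof (rule vf.subspaceI)
    have "0 = affine_field W 0 (\<lambda>_. 0)" by (simp add: vf_eq_iff affine_field_def vf_of_nth)
    then show "0 \<in> K" using vf.subspace_0[OF h(1)] by (intro KI[of _ "\<lambda>_. 0"]) auto
  next
    fix S T assume "S \<in> K" "T \<in> K"
    then obtain \<eta> \<psi> where st: "S = affine_field W 0 \<eta>" "T = affine_field W 0 \<psi>" "\<eta> holomorphic_on ?D" "\<psi> holomorphic_on ?D"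
      "S \<in> \<hh>" "T \<in> \<hh>" by (auto simp: K_def)
    have "S + T = affine_field W 0 (\<lambda>y. \<eta> y + \<psi> y)"
      using affine_field_lincomb[of 1 W 0 \<eta> 1 0 \<psi>] st by simp
    then show "S + T \<in> K"
      by (rule KI[rotated]) (use st vf.subspace_add[OF h(1)] in \<open>auto intro: holomorphic_intros\<close>)
  next
    fix c T assume "T \<in> K"
    then obtain \<eta> where st: "T = affine_field W 0 \<eta>" "\<eta> holomorphic_on ?D" "T \<in> \<hh>" by (auto simp: K_def)
    have "vf_scale c T = affine_field W 0 (\<lambda>y. c * \<eta> y)"
      using affine_field_lincomb[of c W 0 \<eta> 0 0 \<eta>] st by simp
    then show "vf_scale c T \<in> K"
      by (rule KI[rotated]) (use st vf.subspace_scale[OF h(1)] in \<open>auto intro!: holomorphic_intros\<close>)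
  qed
  have br: "lie_bracket S T \<in> K" if S: "S \<in> \<hh>" and T: "T \<in> \<hh>" for S T
  proof -
    obtain c \<eta> d \<psi> where st: "S = affine_field W c \<eta>" "T = affine_field W d \<psi>" "\<eta> holomorphic_on ?D" "\<psi> holomorphic_on ?D"
      using form[OF S] form[OF T] by blast
    have eq: "lie_bracket S T = affine_field W 0 (\<lambda>y. d * \<eta> y - c * \<psi> y)"
      unfolding st by (rule lie_bracket_affine_field[OF W(1) st(3,4)])
    \<comment> \<open>The bracket equals the combination d S - c T of its arguments, so it stays in
      the subspace \<hh>.\<close>
    moreover have "\<dots> = vf_scale d S + vf_scale (- c) T"
      unfolding st affine_field_lincomb by (simp add: mult.commute)
    moreover have "vf_scale d S + vf_scale (- c) T \<in> \<hh>"
      using S T by (intro vf.subspace_add[OF h(1)] vf.subspace_scale[OF h(1)])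
    ultimately have "lie_bracket S T \<in> \<hh>" by simp
    then show ?thesis
      by (rule KI[OF _ eq]) (use st in \<open>auto intro!: holomorphic_intros\<close>)
  qed
  have der: "derived_algebra \<hh> = K"
  proof
    show "derived_algebra \<hh> \<subseteq> K"
      unfolding derived_algebra_def lie_product_def by (rule vf.span_minimal[OF _ K]) (use br in auto)
    show "K \<subseteq> derived_algebra \<hh>"
    proof
      fix T assume "T \<in> K"
      then obtain \<eta> where st: "T = affine_field W 0 \<eta>" "\<eta> holomorphic_on ?D" "T \<in> \<hh>" by (auto simp: K_def)
      have "lie_bracket T ?E = T"
        unfolding st(1) by (subst lie_bracket_affine_field[OF W(1) st(2)]) simp_all
      then show "T \<in> derived_algebra \<hh>"
        unfolding derived_algebra_def lie_product_def using st(3) E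
        by (intro vf.span_base) (metis (mono_tags, lifting) mem_Collect_eq)
    qed
  qed
  have "\<hh> = vf.span {?E} + K"
  proof
    show "\<hh> \<subseteq> vf.span {?E} + K"
    proof
      fix T assume T: "T \<in> \<hh>"
      then obtain c \<eta> where st: "T = affine_field W c \<eta>" "\<eta> holomorphic_on ?D" using form by blast
      have "vf_scale 1 T + vf_scale (- c) ?E = affine_field W 0 \<eta>"
        unfolding st affine_field_lincomb by simp
      moreover have "vf_scale 1 T + vf_scale (- c) ?E \<in> \<hh>"
        using T E by (intro vf.subspace_add[OF h(1)] vf.subspace_scale[OF h(1)])
      ultimately have "affine_field W 0 \<eta> \<in> K" using st(2) by (auto simp: K_def)
      moreover have "T = vf_scale c ?E + vf_scale 1 (affine_field W 0 \<eta>)"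
        unfolding st affine_field_lincomb by simp
      ultimately show "T \<in> vf.span {?E} + K"
        by (auto simp: set_plus_def vf.span_base vf.span_scale)
    qed
    show "vf.span {?E} + K \<subseteq> \<hh>"
      using vf.span_minimal[of "{?E}", OF _ h(1)] E vf.subspace_add[OF h(1)]
      by (auto simp: set_plus_def K_def subset_iff)
  qed
  moreover have "?E = vf_of W (\<lambda>q. q $ 1) (\<lambda>q. 0)" by (simp add: affine_field_def)
  ultimately have 1: "\<hh> = vf.span {vf_of W (\<lambda>q. q $ 1) (\<lambda>q. 0)} + K" by (simp only:)
  have D: "?D = (\<lambda>q. q $ 2) ` W" using snd_image_polydisc[OF W(2), of w] W(1) by simp
  obtain N \<phi> where \<phi>: "K = vf.span {affine_field W 0 (\<phi> i) | i. i \<in> {1..N}}"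
    "\<forall>i\<in>{1..N}. \<phi> i holomorphic_on ?D" "lin_indep_on ?D N \<phi>"
    using span_vertical_fields[OF K h(2) _ _ D] unfolding K_def by blast
  have "affine_field W 0 (\<phi> i) = vf_of W (\<lambda>q. \<phi> i (q $ 2)) (\<lambda>q. 0)" for i
    by (simp add: affine_field_def)
  then have "K = vf.span {vf_of W (\<lambda>q. \<phi> i (q $ 2)) (\<lambda>q. 0) | i. i \<in> {1..N}}"
    using \<phi>(1) by (simp only:)
  moreover have "\<forall>i\<in>{1..N}. C_inf1_on ?D (\<phi> i)"
    using \<phi>(2) C_inf1_on_holomorphic[OF open_ball] by blast
  ultimately show ?thesis
    unfolding rank_one_form_def der D[symmetric] using 1 \<phi>(3) by blast
qed

section \<open>Lie algebras of rank one\<close>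

lemma vfield_on_hol2: "open U \<Longrightarrow> vfield_on U X \<Longrightarrow> hol2_map_on U X"
  by (simp add: vfield_on_def C_inf_map_on_iff)

lemma vfield_on_outside: "vfield_on U X \<Longrightarrow> p \<notin> U \<Longrightarrow> X p = 0"
  by (simp add: vfield_on_def)

lemma lie_bracket_lincomb:
  assumes U: "open U" and X: "vfield_on U X" and Y: "vfield_on U Y" and Z: "vfield_on U Z"
  shows "lie_bracket Z (vf_scale a X + vf_scale b Y) = vf_scale a (lie_bracket Z X) + vf_scale b (lie_bracket Z Y)"
proof
  fix p
  show "lie_bracket Z (vf_scale a X + vf_scale b Y) p = (vf_scale a (lie_bracket Z X) + vf_scale b (lie_bracket Z Y)) p"
  proof (cases "p \<in> U")
    case True
    have Xi: "hol2_on U (\<lambda>q. X q $ i)" and Yi: "hol2_on U (\<lambda>q. Y q $ i)" for i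
      using vfield_on_hol2[OF U X] vfield_on_hol2[OF U Y] by (auto simp: hol2_map_on_def)
    have "dird (\<lambda>q. (vf_scale a X + vf_scale b Y) q $ i) p h = a * dird (\<lambda>q. X q $ i) p h + b * dird (\<lambda>q. Y q $ i) p h" for i h
      unfolding vf_nth vf_scale_nth
        dird_add_fun[OF hol2_on_mult[OF hol2_on_const Xi] hol2_on_mult[OF hol2_on_const Yi] True]
        dird_mult_fun[OF hol2_on_const Xi True] dird_mult_fun[OF hol2_on_const Yi True]
      by (simp add: dird_const)
    then show ?thesis
      by (simp add: vec_eq_iff lie_bracket_nth vf_scale_def dird_add dird_scale algebra_simps)
  next
    case False
    then show ?thesis
      using assms by (simp add: vfield_on_outside[of U] lie_bracket_zero_at vf_scale_def)
  qed
qed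

lemma Jacobi:
  assumes "open U" "vfield_on U X" "vfield_on U Y" "vfield_on U Z"
  shows "lie_bracket Z (lie_bracket X Y) = lie_bracket (lie_bracket Z X) Y + lie_bracket X (lie_bracket Z Y)"
proof
  fix p
  show "lie_bracket Z (lie_bracket X Y) p = (lie_bracket (lie_bracket Z X) Y + lie_bracket X (lie_bracket Z Y)) p"
    using assms Jacobi_at[of U X Y Z p]
    by (cases "p \<in> U") (simp_all add: vfield_on_hol2 vfield_on_outside[of U] lie_bracket_zero_at)
qed

context
  fixes U and \<gg>
  assumes U: "open U" and L: "vf_lie_algebra U \<gg>"
begin

lemma lie_algebra_subspace: "vf.subspace \<gg>"
  and lie_algebra_vfield: "X \<in> \<gg> \<Longrightarrow> vfield_on U X"
  and lie_algebra_bracket: "X \<in> \<gg> \<Longrightarrow> Y \<in> \<gg> \<Longrightarrow> lie_bracket X Y \<in> \<gg>"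
  using L by (auto simp: vf_lie_algebra_def)

text \<open>By the Jacobi identity, ad Z maps a bracket of two elements of an ideal to a sum of two
  such brackets. Invariance under all of \<gg> is what later allows ad Z to be iterated inside one
  member of the series.\<close>

lemma derived_series_ideal:
  "vf.subspace ((derived_algebra ^^ n) \<gg>) \<and> (derived_algebra ^^ n) \<gg> \<subseteq> \<gg> \<and>
    (\<forall>Z\<in>\<gg>. \<forall>A\<in>(derived_algebra ^^ n) \<gg>. lie_bracket Z A \<in> (derived_algebra ^^ n) \<gg>)"
proof (induction n)
  case 0
  then show ?case using lie_algebra_subspace lie_algebra_bracket by simp
next
  case (Suc n)
  define I where "I = (derived_algebra ^^ n) \<gg>"
  define S where "S = {lie_bracket X Y | X Y. X \<in> I \<and> Y \<in> I}"
  have D: "(derived_algebra ^^ Suc n) \<gg> = vf.span S"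
    by (simp add: derived_algebra_def[of I] lie_product_def S_def I_def[symmetric])
  have I: "I \<subseteq> \<gg>" "\<And>Z A. Z \<in> \<gg> \<Longrightarrow> A \<in> I \<Longrightarrow> lie_bracket Z A \<in> I"
    using Suc by (auto simp: I_def)
  have "S \<subseteq> \<gg>" unfolding S_def using I(1) lie_algebra_bracket by blast
  then have sub: "vf.span S \<subseteq> \<gg>" by (rule vf.span_minimal[OF _ lie_algebra_subspace])
  \<comment> \<open>Membership in \<gg> travels along the induction over the span because linearity
    of the bracket is available only for smooth fields on U.\<close>
  have "A \<in> \<gg> \<and> lie_bracket Z A \<in> vf.span S" if Z: "Z \<in> \<gg>" and A: "A \<in> vf.span S" for Z A
    using A
  proof (induction rule: vf.span_induct_alt)
    case base
    have "lie_bracket Z 0 = 0"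
      using lie_bracket_lincomb[OF U lie_algebra_vfield[OF Z] lie_algebra_vfield[OF Z] lie_algebra_vfield[OF Z], of 0 0]
      by simp
    then show ?case using vf.subspace_0[OF lie_algebra_subspace] vf.span_zero[of S] by (simp add: zero_fun_def)
  next
    case (step c A B)
    then obtain X Y where XY: "A = lie_bracket X Y" "X \<in> I" "Y \<in> I" by (auto simp: S_def)
    have v: "vfield_on U X" "vfield_on U Y" "vfield_on U Z"
      using XY Z I(1) lie_algebra_vfield by auto
    have "lie_bracket Z A = lie_bracket (lie_bracket Z X) Y + lie_bracket X (lie_bracket Z Y)"
      unfolding XY(1) by (rule Jacobi[OF U v])
    moreover have "lie_bracket (lie_bracket Z X) Y \<in> S" "lie_bracket X (lie_bracket Z Y) \<in> S"
      using I(2)[OF Z] XY unfolding S_def by blast+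
    ultimately have ZA: "lie_bracket Z A \<in> vf.span S"
      using vf.span_add[OF vf.span_base vf.span_base] by simp
    have A: "A \<in> \<gg>" using step(1) \<open>S \<subseteq> \<gg>\<close> by blast
    have B: "B \<in> \<gg>" "lie_bracket Z B \<in> vf.span S" using step by blast+
    have "lie_bracket Z (vf_scale c A + B) = vf_scale c (lie_bracket Z A) + lie_bracket Z B"
      using lie_bracket_lincomb[OF U lie_algebra_vfield[OF A] lie_algebra_vfield[OF B(1)] v(3), of c 1] by simp
    then have "lie_bracket Z (vf_scale c A + B) \<in> vf.span S"
      using vf.span_add[OF vf.span_scale[OF ZA] B(2)] by simp
    moreover have "vf_scale c A + B \<in> \<gg>"
      by (intro vf.subspace_add[OF lie_algebra_subspace] vf.subspace_scale[OF lie_algebra_subspace] A B(1))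
    ultimately show ?case by (simp add: plus_fun_def)
  qed
  then show ?case using sub unfolding D by (simp add: vf.subspace_span)
qed

end

text \<open>Otherwise every initial segment would be independent and would outgrow a finite spanning
  set. Dependence on earlier terms alone is what later gives a polynomial with leading coefficient
  1.\<close>

lemma finite_dim_dependent:
  fixes A :: "nat \<Rightarrow> vfield"
  assumes "vf_finite_dim \<gg>" "\<And>n. A n \<in> \<gg>"
  shows "\<exists>n. A n \<in> vf.span (A ` {..<n})"
proof (rule ccontr)
  assume *: "\<nexists>n. A n \<in> vf.span (A ` {..<n})"
  have nsp: "A n \<notin> vf.span (A ` {..<n})" for n using * by blast
  have ind: "vf.independent (A ` {..<n}) \<and> card (A ` {..<n}) = n" for n :: nat
  proof (induction n)
    case (Suc n)
    have "A n \<notin> A ` {..<n}" using nsp[of n] vf.span_superset[of "A ` {..<n}"] by blast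
    then show ?case using Suc nsp[of n] by (simp add: lessThan_Suc vf.independent_insert)
  qed (simp add: vf.independent_empty)
  obtain B where B: "finite B" "\<gg> = vf.span B" using assms(1) by (auto simp: vf_finite_dim_def)
  have "A ` {..<Suc (card B)} \<subseteq> vf.span B"
    using assms(2) B(2) by (simp add: image_subset_iff)
  then have "card (A ` {..<Suc (card B)}) \<le> card B"
    using vf.independent_span_bound[OF B(1) conjunct1[OF ind]] by simp
  then show False using ind[of "Suc (card B)"] by simp
qed

text \<open>All iterates of ad Z on X stay in \<aa> and are powers of one function times X. A
  dependence among them is a nontrivial polynomial equation for that function, whose values are then
  finitely many, and a continuous function with finite range on a connected set is constant.\<close>

lemma constant_multiplier:
  assumes B: "open B" "connected B" and X: "hol2_map_on B X" "\<And>q. q \<in> B \<Longrightarrow> X q \<noteq> 0"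
    and f: "hol2_on B f" and Z: "\<And>q. q \<in> B \<Longrightarrow> Z q = f q *s X q"
    and fd: "vf_finite_dim \<gg>" and a: "\<aa> \<subseteq> \<gg>" "X \<in> \<aa>" "\<And>A. A \<in> \<aa> \<Longrightarrow> lie_bracket Z A \<in> \<aa>"
    and ab: "\<And>A q. A \<in> \<aa> \<Longrightarrow> q \<in> B \<Longrightarrow> lie_bracket X A q = 0"
  obtains c where "\<And>q. q \<in> B \<Longrightarrow> dird f q (X q) = c"
proof -
  \<comment> \<open>The sign comes from [f X, X] = -(X f) X, so that ad Z applied to X multiplies it
    by \<psi>.\<close>
  define \<psi> where "\<psi> q = - dird f q (X q)" for q
  have h\<psi>: "hol2_on B \<psi>"
    unfolding \<psi>_def using hol2_on_diff[OF hol2_on_const hol2_on_dird[OF B(1) f X(1)], of 0] by simp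
  have br: "lie_bracket (\<lambda>q. g q *s X q) (\<lambda>q. g' q *s X q) q = (g q * dird g' q (X q) - g' q * dird g q (X q)) *s X q"
    if "hol2_on B g" "hol2_on B g'" "q \<in> B" for g g' q
    by (rule lie_bracket_multiples[OF B(1) X(1) that(1,2) _ _ that(3)]) simp_all
  define A where "A n = (lie_bracket Z ^^ n) X" for n
  have Aa: "A n \<in> \<aa>" for n
    by (induction n) (simp_all add: A_def a)
  have A1: "A 1 q = \<psi> q *s X q" if "q \<in> B" for q
    using lie_bracket_multiples[OF B(1) X(1) f hol2_on_const[of _ 1] Z _ that, of X]
    by (simp add: A_def \<psi>_def dird_const)
  \<comment> \<open>Both X and \<open>A 1\<close> lie in \<aa>, whose brackets with X vanish on B,
    and [X, \<psi> X] = (X \<psi>) X.\<close>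
  have X\<psi>: "dird \<psi> q (X q) = 0" if "q \<in> B" for q
  proof -
    have "lie_bracket X (A 1) q = dird \<psi> q (X q) *s X q"
      using lie_bracket_multiples[OF B(1) X(1) hol2_on_const[of _ 1] h\<psi> _ A1 that, of X]
      by (simp add: dird_const)
    then show ?thesis using ab[OF Aa that] X(2)[OF that] by simp
  qed
  have An: "A n q = \<psi> q ^ n *s X q" if "q \<in> B" for n q
    using that
  proof (induction n arbitrary: q)
    case (Suc n)
    have "A (Suc n) q = (f q * dird (\<lambda>q. \<psi> q ^ n) q (X q) - \<psi> q ^ n * dird f q (X q)) *s X q"
      using lie_bracket_multiples[OF B(1) X(1) f hol2_on_power[OF h\<psi>] Z Suc.IH Suc.prems] by (simp add: A_def)
    then show ?case
      using dird_power[OF h\<psi> Suc.prems] X\<psi>[OF Suc.prems] by (simp add: \<psi>_def mult.commute)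
  qed (simp add: A_def)
  obtain n where n: "A n \<in> vf.span (A ` {..<n})"
    using finite_dim_dependent[OF fd, of A] Aa a(1) by blast
  \<comment> \<open>Asking for \<open>coeff P n = 0\<close> under a bound of n on the degree,
    instead of degree below n, includes n = 0, where the zero polynomial has degree 0. The
    coefficient of R at n is then 1, so R is nonzero.\<close>
  have "\<exists>P. degree P < Suc n \<and> coeff P n = 0 \<and> (\<forall>q\<in>B. T q = poly P (\<psi> q) *s X q)" if "T \<in> vf.span (A ` {..<n})" for T
    using that
  proof (induction rule: vf.span_induct_alt)
    case base
    then show ?case by (intro exI[of _ 0]) simp
  next
    case (step c S T)
    then obtain k P where "k < n" "S = A k" and P: "degree P < Suc n" "coeff P n = 0" "\<forall>q\<in>B. T q = poly P (\<psi> q) *s X q"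
      by blast
    moreover have "degree (monom c k + P) \<le> n"
      using P(1) \<open>k < n\<close> by (intro degree_add_le) (auto intro: order_trans[OF degree_monom_le])
    ultimately show ?case
      by (intro exI[of _ "monom c k + P"]) (auto simp: An vf_scale_def poly_monom vec.scale_left_distrib)
  qed
  then obtain P where P: "coeff P n = 0" "\<forall>q\<in>B. A n q = poly P (\<psi> q) *s X q" using n by blast
  define R where "R = monom 1 n - P"
  have "R \<noteq> 0" using P(1) by (metis R_def coeff_diff coeff_monom coeff_0 diff_zero zero_neq_one)
  moreover have "poly R (\<psi> q) = 0" if "q \<in> B" for q
    using P(2) An[OF that, of n] X(2)[OF that] that by (simp add: R_def poly_monom)
  then have "\<psi> ` B \<subseteq> {x. poly R x = 0}" by auto
  ultimately have "finite (\<psi> ` B)"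
    by (intro finite_subset[OF _ poly_roots_finite])
  then have "\<psi> constant_on B"
    by (intro continuous_finite_range_constant B(2) hol2_on_continuous_on[OF h\<psi>])
  then obtain c where "\<And>q. q \<in> B \<Longrightarrow> \<psi> q = c" unfolding constant_on_def by blast
  then show ?thesis by (intro that[of "- c"]) (simp add: \<psi>_def minus_equation_iff)
qed

section \<open>Push-forwards, collinearity and the chart\<close>

lemma push_forward_linear:
  "push_forward W F G (vf_scale a X + vf_scale b Y) = vf_scale a (push_forward W F G X) + vf_scale b (push_forward W F G Y)"
  by (auto simp: fun_eq_iff push_forward_def vf_scale_def matrix_vector_right_distrib matrix_vector_mult_scale)

lemma push_forward_subspace:
  assumes "vf.subspace \<gg>"
  shows "vf.subspace (push_forward W F G ` \<gg>)"
proof (rule vf.subspaceI)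
  have "push_forward W F G 0 = 0" using push_forward_linear[of W F G 0 0 0 0] by simp
  then show "0 \<in> push_forward W F G ` \<gg>" using vf.subspace_0[OF assms] by (metis imageI)
next
  fix S T assume "S \<in> push_forward W F G ` \<gg>" "T \<in> push_forward W F G ` \<gg>"
  then obtain X Y where "X \<in> \<gg>" "Y \<in> \<gg>" "S = push_forward W F G X" "T = push_forward W F G Y" by blast
  then show "S + T \<in> push_forward W F G ` \<gg>"
    using push_forward_linear[of W F G 1 X 1 Y] vf.subspace_add[OF assms] by (simp add: image_iff) metis
next
  fix c S assume "S \<in> push_forward W F G ` \<gg>"
  then obtain X where "X \<in> \<gg>" "S = push_forward W F G X" by blast
  then show "vf_scale c S \<in> push_forward W F G ` \<gg>"
    using push_forward_linear[of W F G c X 0 X] vf.subspace_scale[OF assms] by (simp add: image_iff) metis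
qed

lemma push_forward_finite_dim:
  assumes "vf_finite_dim \<gg>"
  shows "vf_finite_dim (push_forward W F G ` \<gg>)"
proof -
  obtain B where B: "finite B" "\<gg> = vf.span B" using assms by (auto simp: vf_finite_dim_def)
  have "push_forward W F G T \<in> vf.span (push_forward W F G ` B)" if "T \<in> vf.span B" for T
    using that
  proof (induction rule: vf.span_induct_alt)
    case base
    have "push_forward W F G 0 = 0" using push_forward_linear[of W F G 0 0 0 0] by simp
    then show ?case using vf.span_zero by (simp add: zero_fun_def)
  next
    case (step c S T)
    then have "push_forward W F G (vf_scale c S + T) \<in> vf.span (push_forward W F G ` B)"
      using push_forward_linear[of W F G c S 1 T] vf.span_add[OF vf.span_scale[OF vf.span_base]] by simp
    then show ?case by (simp add: plus_fun_def)
  qed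
  moreover have "vf.span (push_forward W F G ` B) \<subseteq> push_forward W F G ` vf.span B"
    by (rule vf.span_minimal[OF image_mono[OF vf.span_superset] push_forward_subspace[OF vf.subspace_span]])
  ultimately have "push_forward W F G ` \<gg> = vf.span (push_forward W F G ` B)" using B(2) by blast
  then show ?thesis using B(1) unfolding vf_finite_dim_def by blast
qed

text \<open>The determinant of X and Y vanishes wherever the values of \<gg> span a line, that is on
  a dense set, and hence everywhere on U by continuity.\<close>

lemma collinear_of_rank_one:
  assumes U: "open U" and r: "has_rank U \<gg> 1" and X: "X \<in> \<gg>" "hol2_map_on U X" and Y: "Y \<in> \<gg>" "hol2_map_on U Y" and p: "p \<in> U"
  shows "X p $ 1 * Y p $ 2 = X p $ 2 * Y p $ 1"
proof (rule ccontr)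
  assume "X p $ 1 * Y p $ 2 \<noteq> X p $ 2 * Y p $ 1"
  define d where "d q = X q $ 1 * Y q $ 2 - X q $ 2 * Y q $ 1" for q
  obtain G where G: "open G" "G \<subseteq> U" "U \<subseteq> closure G" "\<And>q. q \<in> G \<Longrightarrow> vec.dim ((\<lambda>X. X q) ` \<gg>) = 1"
    using r unfolding has_rank_def generically_def by blast
  have dG: "d q = 0" if q: "q \<in> G" for q
  proof -
    obtain S where S: "S \<subseteq> (\<lambda>X. X q) ` \<gg>" "vec.independent S" "(\<lambda>X. X q) ` \<gg> \<subseteq> vec.span S"
        "card S = vec.dim ((\<lambda>X. X q) ` \<gg>)"
      by (rule vec.basis_exists)
    have "card S = 1" using S(4) G(4)[OF q] by simp
    then obtain b where b: "S = {b}" by (rule card_1_singletonE)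
    have "X q \<in> vec.span {b}" "Y q \<in> vec.span {b}" using S(3) X(1) Y(1) unfolding b by blast+
    then obtain k l where "X q = k *s b" "Y q = l *s b"
      by (auto simp: vec.span_singleton)
    then show ?thesis by (simp add: d_def)
  qed
  have "hol2_on U d"
    unfolding d_def using X(2) Y(2) by (intro hol2_on_diff hol2_on_mult) (auto simp: hol2_map_on_def)
  then have "open (U \<inter> d -` (- {0}))"
    by (intro continuous_open_preimage hol2_on_continuous_on U) auto
  moreover have "p \<in> (U \<inter> d -` (- {0})) \<inter> closure G"
    using p G(3) \<open>X p $ 1 * Y p $ 2 \<noteq> X p $ 2 * Y p $ 1\<close> by (auto simp: d_def)
  ultimately have "(U \<inter> d -` (- {0})) \<inter> G \<noteq> {}"
    using open_Int_closure_eq_empty[of "U \<inter> d -` (- {0})" G] by blast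
  then show False using dG by auto
qed

text \<open>Dividing by a component of X that is nonzero near q gives the multiplier, and
  collinearity takes care of the other component. The ball depends on X alone, so a single ball
  serves all Z.\<close>

lemma local_factor:
  assumes C: "open C" and X: "hol2_map_on C X" and q: "q \<in> C" "X q \<noteq> 0"
  obtains e where "e > 0" "ball q e \<subseteq> C" "\<And>x. x \<in> ball q e \<Longrightarrow> X x \<noteq> 0"
    "\<And>Z. hol2_map_on C Z \<Longrightarrow> (\<And>x. x \<in> C \<Longrightarrow> X x $ 1 * Z x $ 2 = X x $ 2 * Z x $ 1) \<Longrightarrow>
      \<exists>f. hol2_on (ball q e) f \<and> (\<forall>x\<in>ball q e. Z x = f x *s X x)"
proof -
  obtain i where i: "X q $ i \<noteq> 0" using q(2) by (auto simp: vec_eq_iff)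
  have Xi: "hol2_on C (\<lambda>x. X x $ j)" for j using X by (simp add: hol2_map_on_def)
  have "open (C \<inter> (\<lambda>x. X x $ i) -` (- {0}))"
    by (intro continuous_open_preimage hol2_on_continuous_on Xi C) auto
  moreover have "q \<in> C \<inter> (\<lambda>x. X x $ i) -` (- {0})" using q i by simp
  ultimately obtain e where e: "e > 0" "ball q e \<subseteq> C \<inter> (\<lambda>x. X x $ i) -` (- {0})"
    using openE by blast
  show ?thesis
  proof (rule that[OF e(1)])
    show "ball q e \<subseteq> C" using e by blast
    show "X x \<noteq> 0" if "x \<in> ball q e" for x
    proof
      assume "X x = 0"
      moreover have "X x $ i \<noteq> 0" using e(2) that by blast
      ultimately show False by simp
    qed
    show "\<exists>f. hol2_on (ball q e) f \<and> (\<forall>x\<in>ball q e. Z x = f x *s X x)"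
      if Z: "hol2_map_on C Z" "\<And>x. x \<in> C \<Longrightarrow> X x $ 1 * Z x $ 2 = X x $ 2 * Z x $ 1" for Z
    proof (intro exI conjI ballI)
      have Zi: "hol2_on C (\<lambda>x. Z x $ i)" using Z(1) by (simp add: hol2_map_on_def)
      show "hol2_on (ball q e) (\<lambda>x. Z x $ i / X x $ i)"
        by (rule hol2_on_divide[OF hol2_on_subset[OF Zi] hol2_on_subset[OF Xi]]) (use e(2) in auto)
      fix x assume "x \<in> ball q e"
      then have "X x $ i \<noteq> 0" "X x $ 1 * Z x $ 2 = X x $ 2 * Z x $ 1" using e Z(2) by auto
      then show "Z x = (Z x $ i / X x $ i) *s X x"
        using exhaust_2[of i] by (auto simp: vec_eq_iff forall_2 field_simps)
    qed
  qed
qed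

text \<open>h - c x has zero derivative along each horizontal slice. In a polydisc every slice is
  the same convex disc containing the abscissa of the centre, so reading off the value there defines
  one function \<eta> of y for the entire domain.\<close>

lemma affine_in_x:
  assumes h: "hol2_on (polydisc w r) h" and c: "\<And>q. q \<in> polydisc w r \<Longrightarrow> cpd 1 h q = c" and r: "r > 0"
  obtains \<eta> where "\<eta> holomorphic_on ball (w $ 2) r" "\<And>q. q \<in> polydisc w r \<Longrightarrow> h q = c * q $ 1 + \<eta> (q $ 2)"
proof -
  let ?W = "polydisc w r"
  define \<eta> where "\<eta> y = h (axis 2 y + axis 1 (w $ 1)) - c * w $ 1" for y
  have pt: "(axis 2 y + axis 1 x :: complex^2) $ 1 = x" "(axis 2 y + axis 1 x :: complex^2) $ 2 = y" for x y
    by (simp_all add: axis_def)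
  have inW: "axis 2 y + axis 1 x \<in> ?W" if "x \<in> ball (w $ 1) r" "y \<in> ball (w $ 2) r" for x y
    unfolding polydisc_def mem_Collect_eq forall_2 pt using that by simp
  note part = hol2_on_imp_partially_hol_on[OF h]
  have "\<eta> holomorphic_on ball (w $ 2) r"
  proof (rule holomorphic_on_open[THEN iffD2, OF open_ball], rule ballI)
    fix y assume y: "y \<in> ball (w $ 2) r"
    have "((\<lambda>y. h (axis 1 (w $ 1) + axis 2 y)) has_field_derivative cpd 2 h (axis 1 (w $ 1) + axis 2 y)) (at y)"
      by (rule slice_has_derivative[OF part]) (use inW[OF _ y, of "w $ 1"] r in \<open>simp add: add.commute\<close>)
    then have "(\<eta> has_field_derivative cpd 2 h (axis 1 (w $ 1) + axis 2 y) - 0) (at y)"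
      unfolding \<eta>_def add.commute[of "axis 2 _" "axis 1 _"] by (intro DERIV_diff DERIV_const)
    then show "\<exists>d. (\<eta> has_field_derivative d) (at y)" by blast
  qed
  moreover have "h q = c * q $ 1 + \<eta> (q $ 2)" if q: "q \<in> ?W" for q
  proof -
    have y: "q $ 2 \<in> ball (w $ 2) r" and x: "q $ 1 \<in> ball (w $ 1) r" using q by (auto simp: polydisc_def)
    let ?g = "\<lambda>x. h (axis 2 (q $ 2) + axis 1 x) - c * x"
    have "(?g has_field_derivative 0) (at x within ball (w $ 1) r)" if "x \<in> ball (w $ 1) r" for x
    proof -
      have "((\<lambda>x. h (axis 2 (q $ 2) + axis 1 x)) has_field_derivative c) (at x)"
        using slice_has_derivative[OF part inW[OF that y]] c[OF inW[OF that y]] by simp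
      then have "(?g has_field_derivative c - c * 1) (at x)"
        by (intro DERIV_diff DERIV_cmult DERIV_ident)
      then show ?thesis by (simp add: has_field_derivative_at_within)
    qed
    then have "\<exists>d. \<forall>x\<in>ball (w $ 1) r. ?g x = d"
      by (rule has_field_derivative_zero_constant[OF convex_ball])
    then obtain d where d: "\<And>x. x \<in> ball (w $ 1) r \<Longrightarrow> ?g x = d" by blast
    have "?g (q $ 1) = ?g (w $ 1)" using d[OF x] d[of "w $ 1"] r by simp
    then show ?thesis by (simp add: \<eta>_def algebra_simps)
  qed
  ultimately show ?thesis by (rule that)
qed

text \<open>In the chart F = (u, v) with v a first integral, X becomes
  \<open>\<partial>\<^sub>x\<close>. A constant derivative of f along X is then a constant
  x-derivative in the chart, which makes every field affine in x, and Y = u X becomes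
  \<open>x \<partial>\<^sub>x\<close>.\<close>

lemma normal_form_at:
  assumes B: "open B" "p \<in> B" and X: "hol2_map_on B X"
    and \<gg>: "vf.subspace \<gg>" "vf_finite_dim \<gg>"
    and fac: "\<And>Z. Z \<in> \<gg> \<Longrightarrow> \<exists>f c. hol2_on B f \<and> (\<forall>q\<in>B. Z q = f q *s X q) \<and> (\<forall>q\<in>B. dird f q (X q) = c)"
    and Y: "Y \<in> \<gg>" "\<And>q. q \<in> B \<Longrightarrow> Y q = u q *s X q"
    and u: "hol2_on B u" "\<And>q. q \<in> B \<Longrightarrow> dird u q (X q) = 1" "u p = 0"
  shows "\<exists>V W F G. p \<in> V \<and> V \<subseteq> B \<and> coordinate_change V W F G \<and> rank_one_form W (push_forward W F G ` \<gg>)"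
proof -
  obtain V1 v where V1: "open V1" "p \<in> V1" "V1 \<subseteq> B" "hol2_on V1 v" "\<And>q. q \<in> V1 \<Longrightarrow> dird v q (X q) = 0"
    and inv: "invertible (cjac (\<lambda>q. vector [u q, v q]) p)"
    by (rule first_integral_exists[OF B X u], assumption) (rule that)
  define F :: vfield where "F = (\<lambda>q. vector [u q, v q])"
  have F12: "(\<lambda>q. F q $ 1) = u" "(\<lambda>q. F q $ 2) = v" by (simp_all add: F_def)
  have hF: "hol2_map_on V1 F"
    unfolding hol2_map_on_def forall_2 F12 using hol2_on_subset[OF u(1) V1(3)] V1(4) by simp
  obtain V2 W2 G where V2: "open V2" "V2 \<subseteq> V1" "p \<in> V2" "open W2" "homeomorphism V2 W2 F G" "hol2_map_on W2 G"
    and GF: "\<And>q h. q \<in> W2 \<Longrightarrow> cjac G q *v (cjac F (G q) *v h) = h"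
    by (rule hol2_inverse_function[OF V1(1) hF V1(2)]) (use inv in \<open>simp add: F_def\<close>, rule that)
  have "F p \<in> W2" using V2(3,5) by (auto simp: homeomorphism_def)
  then obtain r where r: "r > 0" "polydisc (F p) r \<subseteq> W2" using polydisc_exhausts[OF V2(4)] by blast
  \<comment> \<open>The image is shrunk to a polydisc because the affine form needs all horizontal
    slices to be the same connected disc.\<close>
  define W where "W = polydisc (F p) r"
  have W: "W \<subseteq> W2" using r(2) by (simp add: W_def)
  define V where "V = V2 \<inter> F -` W"
  have GW: "G q \<in> V" "F (G q) = q" if "q \<in> W" for q
    using that W V2(5) by (auto simp: V_def homeomorphism_def)
  have FG: "G (F q) = q" if "q \<in> V" for q
    using that V2(5) by (auto simp: V_def homeomorphism_def)
  have "F q \<in> W" if "q \<in> V" for q using that by (simp add: V_def)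
  then have "G ` W = V" "F ` V = W"
    using GW FG by (metis image_subset_iff image_iff subsetI subset_antisym)+
  have hom: "homeomorphism V W F G"
    by (rule homeomorphism_of_subsets[OF V2(5)]) (use W \<open>F ` V = W\<close> in \<open>auto simp: V_def\<close>)
  have V: "open V" "p \<in> V" "V \<subseteq> V1"
    using continuous_open_preimage[OF hol2_map_on_continuous_on[OF hol2_map_on_subset[OF hF V2(2)]] V2(1) open_polydisc]
      V2 centre_in_polydisc[OF r(1)] by (auto simp: V_def W_def)
  have hG: "hol2_map_on W G" by (rule hol2_map_on_subset[OF V2(6) W])
  have cc: "coordinate_change V W F G"
    unfolding coordinate_change_def
    using V(1) hom hG hol2_map_on_subset[OF hF V(3)] open_polydisc by (simp add: C_inf_map_on_iff W_def)
  \<comment> \<open>The rows of \<open>cjac F\<close> are du and dv, and X u = 1, X v = 0.\<close>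
  have FX: "cjac F q *v X q = axis 1 1" if "q \<in> V1" for q
    using u(2)[of q] V1(3,5) that by (auto simp: vec_eq_iff forall_2 cjac_mult_nth F12 axis_def)
  have push: "push_forward W F G Z = vf_of W (\<lambda>q. f (G q)) (\<lambda>q. 0)"
    if "\<forall>q\<in>B. Z q = f q *s X q" for Z f
  proof
    fix q
    show "push_forward W F G Z q = vf_of W (\<lambda>q. f (G q)) (\<lambda>q. 0) q"
    proof (cases "q \<in> W")
      case True
      then have G: "G q \<in> V1" "G q \<in> B" using GW(1) V(3) V1(3) by auto
      have "cjac F (G q) *v Z (G q) = f (G q) *s axis 1 1"
        using that G(2) FX[OF G(1)] by (simp add: matrix_vector_mult_scale)
      then show ?thesis
        using True by (simp add: push_forward_def vf_of_def vec_eq_iff forall_2 axis_def)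
    qed (simp add: push_forward_def vf_of_def)
  qed
  have "rank_one_form W (push_forward W F G ` \<gg>)"
  proof (rule rank_one_formI[OF W_def r(1) push_forward_subspace[OF \<gg>(1)] push_forward_finite_dim[OF \<gg>(2)]])
    fix T assume "T \<in> push_forward W F G ` \<gg>"
    then obtain Z where Z: "Z \<in> \<gg>" "T = push_forward W F G Z" by blast
    obtain f c where f: "hol2_on B f" "\<forall>q\<in>B. Z q = f q *s X q" "\<And>q. q \<in> B \<Longrightarrow> dird f q (X q) = c"
      using fac[OF Z(1)] by blast
    have GB: "G ` W \<subseteq> B" using \<open>G ` W = V\<close> V(3) V1(3) by blast
    have "cpd 1 (\<lambda>q. f (G q)) q = c" if q: "q \<in> W" for q
    proof -
      have GV: "G q \<in> V1" using GW(1)[OF q] V(3) by blast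
      have "cpd 1 (\<lambda>q. f (G q)) q = dird f (G q) (cjac G q *v axis 1 1)"
        unfolding cpd_eq_dird by (rule dird_compose[OF f(1) hG GB q])
      \<comment> \<open>\<open>cjac G\<close> inverts \<open>cjac F\<close>, which sends X to the
        first unit vector; hence the x-derivative in the chart is the derivative along X.\<close>
      also have "cjac G q *v axis 1 1 = X (G q)"
        using GF[of q "X (G q)"] q W FX[OF GV] by auto
      also have "dird f (G q) (X (G q)) = c" using f(3) GB q by blast
      finally show ?thesis .
    qed
    then obtain \<eta> where \<eta>: "\<eta> holomorphic_on ball (F p $ 2) r" "\<And>q. q \<in> W \<Longrightarrow> f (G q) = c * q $ 1 + \<eta> (q $ 2)"
      using affine_in_x[of "F p" r "\<lambda>q. f (G q)" c] hol2_on_compose[OF f(1) hG GB] r(1) unfolding W_def by metis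
    have "T = affine_field W c \<eta>"
      unfolding Z(2) push[OF f(2)] by (auto simp: affine_field_def vf_eq_iff vf_of_nth \<eta>(2))
    then show "\<exists>c \<eta>. \<eta> holomorphic_on ball (F p $ 2) r \<and> T = affine_field W c \<eta>" using \<eta>(1) by blast
  next
    have "u (G q) = q $ 1" if "q \<in> W" for q
      using GW(2)[OF that] by (simp add: F12(1)[symmetric])
    then have "push_forward W F G Y = affine_field W 1 (\<lambda>_. 0)"
      using push[of Y u] Y(2) by (auto simp: affine_field_def vf_eq_iff vf_of_nth)
    then show "affine_field W 1 (\<lambda>_. 0) \<in> push_forward W F G ` \<gg>" using Y(1) by (metis imageI)
  qed
  then show ?thesis using V V1(3) cc by blast
qed

theorem proposition6p2:
  fixes U :: "(complex^2) set" and \<gg> :: "vfield set"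
  assumes "open U"
    and "vf_lie_algebra U \<gg>"
    and "vf_finite_dim \<gg>"
    and "vf_solvable \<gg>"
    and "\<not> vf_nilpotent \<gg>"
    and "has_rank U \<gg> 1"
  shows "\<exists>C\<in>components U. generically C (locally_in_suitable_coordinates C \<gg> rank_one_form)"
proof -
  note U = assms(1)
  note L = lie_algebra_subspace[OF assms(1,2)] lie_algebra_vfield[OF assms(1,2)] lie_algebra_bracket[OF assms(1,2)]
  have hol: "hol2_map_on U Z" if "Z \<in> \<gg>" for Z
    by (rule vfield_on_hol2[OF U L(2)[OF that]])
  \<comment> \<open>If all brackets vanished, the lower central series would already be zero after
    one step.\<close>
  have "\<exists>A\<in>\<gg>. \<exists>B\<in>\<gg>. lie_bracket A B \<noteq> 0"
  proof (rule ccontr)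
    assume "\<not> ?thesis"
    then have "lie_bracket X Y = 0" if "X \<in> \<gg>" "Y \<in> \<gg>" for X Y
      using that by blast
    then have "{lie_bracket X Y |X Y. X \<in> \<gg> \<and> Y \<in> \<gg>} = {0}"
      using vf.subspace_0[OF L(1)] by (auto intro!: exI[of _ 0])
    then have "(lie_product \<gg> ^^ 1) \<gg> = {0}" by (simp add: lie_product_def)
    then show False using assms(5) unfolding vf_nilpotent_def by blast
  qed
  then obtain A B p0 where AB: "A \<in> \<gg>" "B \<in> \<gg>" "lie_bracket A B p0 \<noteq> 0"
    by (auto simp: fun_eq_iff)
  have p0: "p0 \<in> U"
    using AB(3) lie_bracket_zero_at vfield_on_outside[OF L(2)[OF AB(1)]] vfield_on_outside[OF L(2)[OF AB(2)]] by blast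
  \<comment> \<open>This component contains the point p0 with a nonzero bracket. On another
    component \<gg> might be abelian.\<close>
  define C where "C = connected_component_set U p0"
  have C: "C \<in> components U" "open C" "connected C" "C \<subseteq> U" "p0 \<in> C"
    using p0 U by (auto simp: C_def components_def open_connected_component connected_component_subset)
  have identity: "T q = 0"
    if "hol2_map_on U T" "open S" "S \<subseteq> C" "S \<noteq> {}" "\<And>q. q \<in> S \<Longrightarrow> T q = 0" "q \<in> C" for T S q
  proof -
    have "T q $ i = 0" for i
      by (rule hol2_on_identity[of C "\<lambda>q. T q $ i", OF _ C(2,3) that(2-4) _ that(6)])
         (use that(1,5) hol2_on_subset[OF _ C(4)] in \<open>auto simp: hol2_map_on_def\<close>)
    then show ?thesis by (simp add: vec_eq_iff)
  qed

  \<comment> \<open>Vanishing is tested on C only, since a member of the derived series can be zero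
    there and nonzero elsewhere. The bracket at p0 excludes \<open>van 0\<close> and solvability
    provides some \<open>van n\<close>, so there is a switch at some k. The brackets within \<aa>
    then vanish on C.\<close>
  define van where "van n \<longleftrightarrow> (\<forall>Z\<in>(derived_algebra ^^ n) \<gg>. \<forall>q\<in>C. Z q = 0)" for n
  obtain n where "(derived_algebra ^^ n) \<gg> = {0}" using assms(4) by (auto simp: vf_solvable_def)
  then have "van n" by (simp add: van_def)
  moreover have "\<not> van 0" using AB C(5) L(3) by (auto simp: van_def)
  moreover have "\<not> van n" if "\<And>k. \<not> van k \<Longrightarrow> \<not> van (Suc k)" "\<not> van 0" for n
    using that by (induction n) blast+
  ultimately obtain k where k: "\<not> van k" "van (Suc k)" by blast
  define \<aa> where "\<aa> = (derived_algebra ^^ k) \<gg>"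
  have a: "vf.subspace \<aa>" "\<aa> \<subseteq> \<gg>" "\<And>Z A. Z \<in> \<gg> \<Longrightarrow> A \<in> \<aa> \<Longrightarrow> lie_bracket Z A \<in> \<aa>"
    using derived_series_ideal[OF assms(1,2), of k] by (auto simp: \<aa>_def)
  have ab: "lie_bracket A B q = 0" if "A \<in> \<aa>" "B \<in> \<aa>" "q \<in> C" for A B q
  proof -
    have "lie_bracket A B \<in> (derived_algebra ^^ Suc k) \<gg>"
      using that(1,2) by (auto simp: derived_algebra_def[of "(derived_algebra ^^ k) \<gg>"] lie_product_def \<aa>_def intro!: vf.span_base)
    then show ?thesis using k(2) that(3) unfolding van_def by blast
  qed
  obtain X x0 where X: "X \<in> \<aa>" "x0 \<in> C" "X x0 \<noteq> 0"
    using k(1) by (auto simp: van_def \<aa>_def)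
  have Xg: "X \<in> \<gg>" using X a by blast
  note hX = hol2_map_on_subset[OF hol[OF Xg] C(4)]
  \<comment> \<open>These are the generic points of the conclusion. They are dense in C, for if X
    vanished on an open part of C it would vanish at x0 by the identity theorem.\<close>
  define G where "G = {q \<in> C. X q \<noteq> 0}"
  have "G = C \<inter> X -` (- {0})" by (auto simp: G_def)
  moreover have "open (C \<inter> X -` (- {0}))"
    by (rule continuous_open_preimage[OF hol2_map_on_continuous_on[OF hX] C(2)]) (simp add: open_Compl)
  ultimately have "open G" by simp
  then have G: "open G" "G \<subseteq> C" "x0 \<in> G"
    using X by (simp_all add: G_def)
  have dense: "C \<subseteq> closure G"
  proof
    fix q assume "q \<in> C"
    show "q \<in> closure G"
    proof (rule ccontr)
      assume "q \<notin> closure G"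
      then have ne: "C - closure G \<noteq> {}" using \<open>q \<in> C\<close> by blast
      have "X x0 = 0"
      proof (rule identity[OF hol[OF Xg] _ _ ne _ X(2)])
        show "open (C - closure G)" by (rule open_Diff[OF C(2) closed_closure])
        show "X x = 0" if "x \<in> C - closure G" for x
          using that closure_subset[of G] by (auto simp: G_def)
      qed blast
      then show False using X by simp
    qed
  qed
  have coll: "X x $ 1 * Z x $ 2 = X x $ 2 * Z x $ 1" if "Z \<in> \<gg>" "x \<in> C" for Z x
    using collinear_of_rank_one[OF U assms(6) Xg hol[OF Xg] that(1) hol[OF that(1)]] that(2) C(4) by blast

  have factor: "\<exists>e>0. ball p e \<subseteq> G \<and> (\<forall>Z\<in>\<gg>. \<exists>f c. hol2_on (ball p e) f \<and>
      (\<forall>q\<in>ball p e. Z q = f q *s X q) \<and> (\<forall>q\<in>ball p e. dird f q (X q) = c))" if p: "p \<in> G" for p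
  proof -
    have "p \<in> C" "X p \<noteq> 0" using p by (auto simp: G_def)
    then obtain e where e: "e > 0" "ball p e \<subseteq> C" "\<And>x. x \<in> ball p e \<Longrightarrow> X x \<noteq> 0"
      and fac: "\<And>Z. hol2_map_on C Z \<Longrightarrow> (\<And>x. x \<in> C \<Longrightarrow> X x $ 1 * Z x $ 2 = X x $ 2 * Z x $ 1) \<Longrightarrow>
        \<exists>f. hol2_on (ball p e) f \<and> (\<forall>x\<in>ball p e. Z x = f x *s X x)"
      using local_factor[OF C(2) hX] by metis
    have "\<exists>f c. hol2_on (ball p e) f \<and> (\<forall>q\<in>ball p e. Z q = f q *s X q) \<and> (\<forall>q\<in>ball p e. dird f q (X q) = c)"
      if Z: "Z \<in> \<gg>" for Z
    proof -
      obtain f where f: "hol2_on (ball p e) f" "\<And>x. x \<in> ball p e \<Longrightarrow> Z x = f x *s X x"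
        using fac[OF hol2_map_on_subset[OF hol[OF Z] C(4)] coll[OF Z]] by blast
      obtain c where "\<And>q. q \<in> ball p e \<Longrightarrow> dird f q (X q) = c"
        by (rule constant_multiplier[OF open_ball connected_ball hol2_map_on_subset[OF hX e(2)] e(3) f assms(3) a(2) X(1) a(3)[OF Z] ab[OF X(1)]])
          (use e(2) in auto)
      then show ?thesis using f by blast
    qed
    moreover have "ball p e \<subseteq> G" using e(2,3) by (auto simp: G_def)
    ultimately show ?thesis using e(1) by blast
  qed

  \<comment> \<open>If X commuted on C with all of \<gg>, every multiplier would satisfy X f = 0 and
    the bracket of A and B would vanish on G. The identity theorem would carry this to p0.\<close>
  have "\<exists>Z\<in>\<gg>. \<exists>q\<in>C. lie_bracket X Z q \<noteq> 0"
  proof (rule ccontr)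
    assume *: "\<not> ?thesis"
    have zero: "lie_bracket A B q = 0" if q: "q \<in> G" for q
    proof -
      obtain e where e: "e > 0" "ball q e \<subseteq> G" and fac: "\<And>Z. Z \<in> \<gg> \<Longrightarrow> \<exists>f c. hol2_on (ball q e) f \<and>
        (\<forall>q\<in>ball q e. Z q = f q *s X q) \<and> (\<forall>q\<in>ball q e. dird f q (X q) = c)"
        using factor[OF q] by blast
      have hXe: "hol2_map_on (ball q e) X" by (rule hol2_map_on_subset[OF hX]) (use e G in blast)
      have qe: "q \<in> ball q e" using e by simp
      have Xf: "dird f q (X q) = 0"
        if Z: "Z \<in> \<gg>" and f: "hol2_on (ball q e) f" "\<forall>x\<in>ball q e. Z x = f x *s X x" for Z f
      proof -
        have "lie_bracket X Z q = dird f q (X q) *s X q"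
          using lie_bracket_multiples[OF open_ball hXe hol2_on_const[of _ 1] f(1) _ _ qe, of X Z] f(2) by (simp add: dird_const)
        then show ?thesis using * Z q G by (auto simp: G_def)
      qed
      obtain f g where f: "hol2_on (ball q e) f" "\<forall>x\<in>ball q e. A x = f x *s X x"
        and g: "hol2_on (ball q e) g" "\<forall>x\<in>ball q e. B x = g x *s X x"
        using fac[OF AB(1)] fac[OF AB(2)] by blast
      show ?thesis
        using lie_bracket_multiples[OF open_ball hXe f(1) g(1) _ _ qe, of A B] f(2) g(2)
          Xf[OF AB(1) f] Xf[OF AB(2) g] by simp
    qed
    have "lie_bracket A B p0 = 0"
      by (rule identity[OF hol[OF L(3)[OF AB(1,2)]] G(1,2) _ zero C(5)]) (use G(3) in auto)
    then show False using AB(3) by simp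
  qed
  then obtain Z0 q0 where Z0: "Z0 \<in> \<gg>" "q0 \<in> C" "lie_bracket X Z0 q0 \<noteq> 0" by blast

  have "locally_in_suitable_coordinates C \<gg> rank_one_form p" if p: "p \<in> G" for p
  proof -
    obtain e where e: "e > 0" "ball p e \<subseteq> G" and fac: "\<And>Z. Z \<in> \<gg> \<Longrightarrow> \<exists>f c. hol2_on (ball p e) f \<and>
      (\<forall>q\<in>ball p e. Z q = f q *s X q) \<and> (\<forall>q\<in>ball p e. dird f q (X q) = c)"
      using factor[OF p] by blast
    let ?B = "ball p e"
    have eC: "?B \<subseteq> C" using e(2) G(2) by blast
    have hXe: "hol2_map_on ?B X" by (rule hol2_map_on_subset[OF hX eC])
    obtain f c where f: "hol2_on ?B f" "\<And>q. q \<in> ?B \<Longrightarrow> Z0 q = f q *s X q" "\<And>q. q \<in> ?B \<Longrightarrow> dird f q (X q) = c"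
      using fac[OF Z0(1)] by blast
    \<comment> \<open>The constant belongs to the ball around p, but it cannot be 0: [X, Z0] = c X
      would vanish on the ball and hence at q0. Thus the same Z0 serves every p in G.\<close>
    have "c \<noteq> 0"
    proof
      assume "c = 0"
      have zero: "lie_bracket X Z0 q = 0" if "q \<in> ?B" for q
        using lie_bracket_multiples[OF open_ball hXe hol2_on_const[of _ 1] f(1) _ f(2) that, of X] f(3)[OF that] \<open>c = 0\<close>
        by (simp add: dird_const)
      have "lie_bracket X Z0 q0 = 0"
        by (rule identity[OF hol[OF L(3)[OF Xg Z0(1)]] open_ball eC _ zero Z0(2)]) (use e(1) in auto)
      then show False using Z0(3) by simp
    qed
    \<comment> \<open>Division by c achieves X u = 1. Subtracting the constant f p / c gives u p =
      0, as the Lie series requires, and changes the field only by a constant multiple of X, which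
      lies in \<gg>.\<close>
    define u where "u q = (1 / c) * f q - f p / c" for q
    define Y where "Y = vf_scale (1 / c) Z0 + vf_scale (- (f p / c)) X"
    have "\<exists>V W F H. p \<in> V \<and> V \<subseteq> ?B \<and> coordinate_change V W F H \<and> rank_one_form W (push_forward W F H ` \<gg>)"
    proof (rule normal_form_at[OF open_ball _ hXe L(1) assms(3) fac])
      show "p \<in> ?B" using e(1) by simp
      show "Y \<in> \<gg>"
        unfolding Y_def by (intro vf.subspace_add[OF L(1)] vf.subspace_scale[OF L(1)] Z0(1) Xg)
      show "Y q = u q *s X q" if "q \<in> ?B" for q
        by (simp add: Y_def u_def vf_scale_def f(2)[OF that] vec_eq_iff algebra_simps)
      note 1 = hol2_on_mult[OF hol2_on_const f(1), of "1 / c"]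
      show "hol2_on ?B u" unfolding u_def by (rule hol2_on_diff[OF 1 hol2_on_const])
      show "dird u q (X q) = 1" if "q \<in> ?B" for q
        unfolding u_def dird_diff_fun[OF 1 hol2_on_const that] dird_mult_fun[OF hol2_on_const f(1) that]
        using f(3)[OF that] \<open>c \<noteq> 0\<close> by (simp add: dird_const)
      show "u p = 0" by (simp add: u_def)
    qed
    then show ?thesis
      unfolding locally_in_suitable_coordinates_def using eC by (meson subset_trans)
  qed
  then have "generically C (locally_in_suitable_coordinates C \<gg> rank_one_form)"
    unfolding generically_def using G dense by blast
  then show ?thesis using C(1) by blast
qed

end
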